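(* Let $\mathcal{H}_A\otimes\mathcal{H}_B$ be a finite-dimensional bipartite Hilbert space. Every pure product state $|\Psi\rangle\in\mathcal{H}_A\otimes\mathcal{H}_B$ can be verified by a strategy that uses one measurement setting (based on nonadaptive local projective measurements). Every pure entangled state $|\Psi\rangle\in\mathcal{H}_A\otimes\mathcal{H}_B$ can be verified by a strategy that uses two measurement settings, but cannot be verified by any strategy that uses only one measurement setting.
   Context: Verification of a pure state $|\Psi\rangle$: a test is a two-outcome measurement $\{E,I-E\}$ with $0\le E\le I$ and $E|\Psi\rangle=|\Psi\rangle$ (the first outcome means "pass"). A strategy performs test $E_l$ with probability $p_l>0$; its verification operator is $\Omega=\sum_l p_lE_l$. The strategy verifies $|\Psi\rangle$ iff the spectral gap $\nu(\Omega)=1-\beta(\Omega)$ is positive, where $\beta(\Omega)$ is the second largest eigenvalue of $\Omega$ (counted with multiplicity). Tests are realized by nonadaptive local projective measurements: a measurement setting is a choice of one projective measurement $\{A_i\}$ for Alice and one projective measurement $\{B_j\}$ for Bob, performed independently; a test realized by this setting has test operator $E=\sum_{(i,j)\in S}A_i\otimes B_j$ for some accepted set $S$ of outcome pairs. The number of measurement settings of a strategy is the number of distinct settings needed to realize all its tests. *)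

theory Defs
  imports "Jordan_Normal_Form.Schur_Decomposition" "HOL-Library.Multiset"
begin

(* Kronecker (tensor) product; index of |i>|j> in C^dA (x) C^dB is i*dB + j *)
definition kron :: "complex mat \<Rightarrow> complex mat \<Rightarrow> complex mat" where
  "kron A B = mat (dim_row A * dim_row B) (dim_col A * dim_col B)
     (\<lambda>(r,c). A $$ (r div dim_row B, c div dim_col B) * B $$ (r mod dim_row B, c mod dim_col B))"

definition kron_vec :: "complex vec \<Rightarrow> complex vec \<Rightarrow> complex vec" where
  "kron_vec a b = vec (dim_vec a * dim_vec b) (\<lambda>r. a $ (r div dim_vec b) * b $ (r mod dim_vec b))"

definition pure_state :: "nat \<Rightarrow> complex vec \<Rightarrow> bool" where
  "pure_state D \<Psi> \<longleftrightarrow> \<Psi> \<in> carrier_vec D \<and> \<Psi> \<bullet>c \<Psi> = 1"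

definition product_state :: "nat \<Rightarrow> nat \<Rightarrow> complex vec \<Rightarrow> bool" where
  "product_state dA dB \<Psi> \<longleftrightarrow>
     (\<exists>a \<in> carrier_vec dA. \<exists>b \<in> carrier_vec dB. \<Psi> = kron_vec a b)"

definition psd :: "nat \<Rightarrow> complex mat \<Rightarrow> bool" where
  "psd D M \<longleftrightarrow> M \<in> carrier_mat D D \<and> mat_adjoint M = M \<and>
     (\<forall>v \<in> carrier_vec D. 0 \<le> Re ((M *\<^sub>v v) \<bullet>c v))"

definition is_test :: "nat \<Rightarrow> complex vec \<Rightarrow> complex mat \<Rightarrow> bool" where
  "is_test D \<Psi> E \<longleftrightarrow> psd D E \<and> psd D (1\<^sub>m D - E) \<and> E *\<^sub>v \<Psi> = \<Psi>"

definition proj_meas :: "nat \<Rightarrow> complex mat list \<Rightarrow> bool" where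
  "proj_meas d Ps \<longleftrightarrow>
     (\<forall>P \<in> set Ps. P \<in> carrier_mat d d \<and> mat_adjoint P = P \<and> P * P = P) \<and>
     foldr (+) Ps (0\<^sub>m d d) = 1\<^sub>m d"

definition setting :: "nat \<Rightarrow> nat \<Rightarrow> complex mat list \<times> complex mat list \<Rightarrow> bool" where
  "setting dA dB s \<longleftrightarrow> proj_meas dA (fst s) \<and> proj_meas dB (snd s)"

(* test operator realized by a setting with accepted set S of outcome pairs *)
definition realized_test :: "nat \<Rightarrow> nat \<Rightarrow> complex mat list \<times> complex mat list \<Rightarrow> (nat \<times> nat) set \<Rightarrow> complex mat" where
  "realized_test dA dB s S = mat (dA * dB) (dA * dB)
     (\<lambda>rc. \<Sum>(i,j) \<in> S. kron (fst s ! i) (snd s ! j) $$ rc)"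

definition realizes :: "nat \<Rightarrow> nat \<Rightarrow> complex mat list \<times> complex mat list \<Rightarrow> complex mat \<Rightarrow> bool" where
  "realizes dA dB s E \<longleftrightarrow>
     (\<exists>S. S \<subseteq> {0..<length (fst s)} \<times> {0..<length (snd s)} \<and> E = realized_test dA dB s S)"

(* a strategy: list of (probability p_l, test operator E_l) *)
type_synonym strategy = "(real \<times> complex mat) list"

definition valid_strategy :: "nat \<Rightarrow> complex vec \<Rightarrow> strategy \<Rightarrow> bool" where
  "valid_strategy D \<Psi> st \<longleftrightarrow> st \<noteq> [] \<and> (\<forall>(p,E) \<in> set st. p > 0 \<and> is_test D \<Psi> E)
     \<and> (\<Sum>(p,E) \<leftarrow> st. p) = 1"

definition ver_op :: "nat \<Rightarrow> strategy \<Rightarrow> complex mat" where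
  "ver_op D st = mat D D (\<lambda>rc. \<Sum>(p,E) \<leftarrow> st. complex_of_real p * E $$ rc)"

definition eig_mset :: "complex mat \<Rightarrow> complex multiset" where
  "eig_mset A = (SOME M. char_poly A = (\<Prod>a \<in># M. [:- a, 1:]))"

(* second largest eigenvalue (Omega is Hermitian, so eigenvalues are real) *)
definition beta :: "complex mat \<Rightarrow> real" where
  "beta A = (let xs = sorted_list_of_multiset (image_mset Re (eig_mset A))
             in xs ! (length xs - 2))"

definition spectral_gap :: "complex mat \<Rightarrow> real" where
  "spectral_gap A = 1 - beta A"

definition verifies :: "nat \<Rightarrow> nat \<Rightarrow> complex vec \<Rightarrow> strategy \<Rightarrow> bool" where
  "verifies dA dB \<Psi> st \<longleftrightarrow> valid_strategy (dA * dB) \<Psi> st \<and> spectral_gap (ver_op (dA * dB) st) > 0"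

definition uses_settings :: "nat \<Rightarrow> nat \<Rightarrow> strategy \<Rightarrow> nat \<Rightarrow> bool" where
  "uses_settings dA dB st k \<longleftrightarrow>
     (\<exists>ss. length ss \<le> k \<and> (\<forall>s \<in> set ss. setting dA dB s) \<and>
        (\<forall>(p,E) \<in> set st. \<exists>s \<in> set ss. realizes dA dB s E))"

end

theory Submission
  imports Defs "HOL-Combinatorics.Permutations"
begin

text \<open>A strategy has positive spectral gap iff the only vectors fixed by its verification operator are the
  multiples of \<open>\<Psi>\<close>, and a vector is fixed by the verification operator iff it passes every test with certainty.
  A product state is verified by projecting onto its two factors. For an arbitrary state with Schmidt
  decomposition \<open>\<Psi> = (\<Sum>i. u i \<otimes> v i)\<close>, one setting checks the correlations in the Schmidt bases and a
  second one checks coherence: if Alice finds \<open>\<Sum>i. u i\<close>, Bob has to find \<open>\<Sum>i. v i\<close>. Conversely, with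
  a single setting \<open>A i \<otimes> B j\<close>, every test accepts each outcome pair \<open>(i, j)\<close> that has nonzero probability
  in \<open>\<Psi>\<close>, hence passes all product vectors in the range of \<open>A i \<otimes> B j\<close>; a positive gap forces these to be
  multiples of \<open>\<Psi>\<close>.\<close>

subsection \<open>Adjoints and inner products\<close>

text \<open>\<open>beta\<close> is read off a sorted list of roots of \<open>char_poly\<close>, so
  it counts eigenvalues with multiplicity. The spectral theorem is what turns a statement about this
  list into one about fixed vectors, and the dimension must be at least 2 for a second entry to
  exist. Passing from the average to the single tests works because all weights are positive and no
  test exceeds the identity: the average attains the upper bound at a vector only if every test
  does, and a projection that attains it fixes the vector. A single coherence check suffices for the
  following reason. The Schmidt coefficients are absorbed into the vectors \<open>v i\<close>, and
  the unnormalized sum of the \<open>u i\<close> has inner product 1 with each of them. When Alice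
  finds this sum, the index is erased without any reweighting, and Bob holds the combination of the
  orthogonal \<open>v i\<close> with exactly the coefficients left free by the first test. Comparing
  his state with the one that \<open>\<Psi>\<close> produces therefore tests all coefficients at
  once.\<close>

lemma adjoint_carrier [simp]: "A \<in> carrier_mat n m \<Longrightarrow> mat_adjoint A \<in> carrier_mat m n"
  by (auto simp: mat_adjoint_def mat_of_rows_def)

lemma adjoint_dim [simp]: "dim_row (mat_adjoint A) = dim_col A" "dim_col (mat_adjoint A) = dim_row A"
  by (auto simp: mat_adjoint_def)

lemma adjoint_index [simp]:
  fixes A :: "complex mat"
  assumes "i < dim_col A" "j < dim_row A"
  shows "mat_adjoint A $$ (i, j) = cnj (A $$ (j, i))"
  using assms by (auto simp: mat_adjoint_def mat_of_rows_def)

lemma cscalar_prod_sum: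
  fixes v w :: "complex vec"
  shows "v \<bullet>c w = (\<Sum>i<dim_vec w. v $ i * cnj (w $ i))"
  by (auto simp: scalar_prod_def atLeast0LessThan intro!: sum.cong)

lemma mult_vec_index_sum:
  fixes A :: "complex mat"
  assumes "A \<in> carrier_mat n m" "v \<in> carrier_vec m" "i < n"
  shows "(A *\<^sub>v v) $ i = (\<Sum>j<m. A $$ (i, j) * v $ j)"
  using assms by (auto simp: scalar_prod_def atLeast0LessThan intro!: sum.cong)

lemma mult_mat_index_sum:
  fixes A :: "complex mat"
  assumes "A \<in> carrier_mat n m" "B \<in> carrier_mat m k" "i < n" "j < k"
  shows "(A * B) $$ (i, j) = (\<Sum>l<m. A $$ (i, l) * B $$ (l, j))"
  using assms by (auto simp: scalar_prod_def atLeast0LessThan intro!: sum.cong)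

lemma adjoint_adjoint [simp]:
  fixes A :: "complex mat"
  shows "mat_adjoint (mat_adjoint A) = A"
  by (rule eq_matI) auto

lemma adjoint_mult:
  fixes A :: "complex mat"
  assumes "A \<in> carrier_mat n m" "B \<in> carrier_mat m k"
  shows "mat_adjoint (A * B) = mat_adjoint B * mat_adjoint A"
proof (rule eq_matI)
  fix i j assume "i < dim_row (mat_adjoint B * mat_adjoint A)" "j < dim_col (mat_adjoint B * mat_adjoint A)"
  hence ij: "i < k" "j < n" using assms by auto
  have "mat_adjoint (A * B) $$ (i, j) = (\<Sum>l<m. cnj (A $$ (j, l) * B $$ (l, i)))"
    using assms ij by (simp del: index_mult_mat(1) add: mult_mat_index_sum[OF assms] )
  also have "\<dots> = (mat_adjoint B * mat_adjoint A) $$ (i, j)"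
    using assms ij
    by (subst mult_mat_index_sum[of _ k m _ n]) (auto simp: mult.commute intro!: sum.cong)
  finally show "mat_adjoint (A * B) $$ (i, j) = (mat_adjoint B * mat_adjoint A) $$ (i, j)" .
qed (use assms in auto)

lemma adjoint_one [simp]: "mat_adjoint (1\<^sub>m n :: complex mat) = 1\<^sub>m n"
  by (rule eq_matI) auto

lemma adjoint_minus:
  fixes A :: "complex mat"
  assumes "A \<in> carrier_mat n m" "B \<in> carrier_mat n m"
  shows "mat_adjoint (A - B) = mat_adjoint A - mat_adjoint B"
  using assms by (intro eq_matI) auto

lemma cscalar_prod_adjoint:
  fixes A :: "complex mat"
  assumes A: "A \<in> carrier_mat n m" and v: "v \<in> carrier_vec m" and w: "w \<in> carrier_vec n"
  shows "(A *\<^sub>v v) \<bullet>c w = v \<bullet>c (mat_adjoint A *\<^sub>v w)"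
proof -
  have "(A *\<^sub>v v) \<bullet>c w = (\<Sum>i<n. \<Sum>j<m. A $$ (i, j) * v $ j * cnj (w $ i))"
    using w by (simp add: cscalar_prod_sum mult_vec_index_sum[OF A v] sum_distrib_right
        del: index_mult_mat_vec)
  also have "\<dots> = (\<Sum>j<m. \<Sum>i<n. A $$ (i, j) * v $ j * cnj (w $ i))"
    by (rule sum.swap)
  also have "\<dots> = v \<bullet>c (mat_adjoint A *\<^sub>v w)"
  proof -
    have "v $ j * cnj ((mat_adjoint A *\<^sub>v w) $ j) = (\<Sum>i<n. A $$ (i, j) * v $ j * cnj (w $ i))"
      if "j < m" for j
      using A that by (simp add: mult_vec_index_sum[OF adjoint_carrier[OF A] w] sum_distrib_left
        mult_ac del: index_mult_mat_vec)
    thus ?thesis using A by (simp add: cscalar_prod_sum)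
  qed
  finally show ?thesis .
qed

lemma cscalar_prod_self:
  fixes v :: "complex vec"
  shows "v \<bullet>c v = complex_of_real (\<Sum>i<dim_vec v. (cmod (v $ i))\<^sup>2)"
  unfolding cscalar_prod_sum of_real_sum
  by (intro sum.cong refl) (metis complex_norm_square of_real_power)

lemma cscalar_prod_self_nonneg: "0 \<le> Re ((v :: complex vec) \<bullet>c v)"
  by (simp add: cscalar_prod_self sum_nonneg)

lemma cscalar_prod_self_eq_0:
  fixes v :: "complex vec"
  assumes "v \<in> carrier_vec n"
  shows "Re (v \<bullet>c v) = 0 \<longleftrightarrow> v = 0\<^sub>v n"
proof -
  have "Re (v \<bullet>c v) = 0 \<longleftrightarrow> v \<bullet>c v = 0"
    by (simp add: cscalar_prod_self del: of_real_sum)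
  thus ?thesis using conjugate_square_eq_0_vec[OF assms] by simp
qed

lemma cscalar_prod_commute:
  fixes v w :: "complex vec"
  assumes "v \<in> carrier_vec n" "w \<in> carrier_vec n"
  shows "w \<bullet>c v = cnj (v \<bullet>c w)"
  using assms by (simp add: cscalar_prod_sum mult.commute)

lemma mat_eq_by_mult_vec:
  fixes A B :: "complex mat"
  assumes A: "A \<in> carrier_mat n m" and B: "B \<in> carrier_mat n m"
    and eq: "\<And>v. v \<in> carrier_vec m \<Longrightarrow> A *\<^sub>v v = B *\<^sub>v v"
  shows "A = B"
proof (rule eq_matI)
  fix i j assume "i < dim_row B" "j < dim_col B"
  hence ij: "i < n" "j < m" using B by auto
  have "M $$ (i, j) = (M *\<^sub>v unit_vec m j) $ i" if "M \<in> carrier_mat n m" for M :: "complex mat"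
    using that ij by simp
  thus "A $$ (i, j) = B $$ (i, j)" using A B eq[of "unit_vec m j"] by simp
qed (use assms in auto)

subsection \<open>The spectral theorem for Hermitian matrices\<close>

text \<open>Gram-Schmidt on a basis that begins with \<open>v\<close> keeps \<open>v\<close> as its
  first vector. The columns are normalized afterwards, so the first one is a multiple of
  \<open>v\<close> rather than \<open>v\<close> itself.\<close>

lemma unitary_extension:
  fixes v :: "complex vec"
  assumes v: "v \<in> carrier_vec n" and v0: "v \<noteq> 0\<^sub>v n"
  obtains W c where "W \<in> carrier_mat n n" "mat_adjoint W * W = 1\<^sub>m n" "col W 0 = c \<cdot>\<^sub>v v"
proof -
  interpret cof_vec_space n "TYPE(complex)" .
  define b where "b = basis_completion v"
  note bc = basis_completion[OF v v0, folded b_def]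
  define ws where "ws = gram_schmidt n b"
  have n: "n \<noteq> 0" using v v0 by auto
  obtain vs where bv: "b = v # vs" using bc n by (cases b) auto
  note gs = gram_schmidt_result[OF bc(2) bc(4) bc(5) ws_def]
  have hdws: "hd ws = v" unfolding ws_def bv using gram_schmidt_hd[OF v] .
  have len: "length ws = n" using gs bc by simp
  have wsc: "ws ! i \<in> carrier_vec n" if "i < n" for i using gs(3) len that by auto
  \<comment> \<open>The reciprocal norms; being real, they pass unchanged through
    conjugation.\<close>
  define r where "r i = complex_of_real (1 / sqrt (Re (ws ! i \<bullet>c ws ! i)))" for i
  have cnj_r: "cnj (r i) = r i" for i by (simp add: r_def)
  define W where "W = mat n n (\<lambda>(i, j). r j * ws ! j $ i)"
  have W: "W \<in> carrier_mat n n" by (simp add: W_def)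
  have "mat_adjoint W * W = 1\<^sub>m n"
  proof (rule eq_matI)
    fix i j assume "i < dim_row (1\<^sub>m n :: complex mat)" "j < dim_col (1\<^sub>m n :: complex mat)"
    hence ij: "i < n" "j < n" by auto
    have "(mat_adjoint W * W) $$ (i, j) = (\<Sum>l<n. cnj (W $$ (l, i)) * W $$ (l, j))"
      using ij W by (subst mult_mat_index_sum[of _ n n _ n]) auto
    also have "\<dots> = r i * r j * (ws ! j \<bullet>c ws ! i)"
      using ij wsc[OF ij(1)] by (simp add: W_def cscalar_prod_sum sum_distrib_left cnj_r mult_ac)
    also have "\<dots> = (if i = j then 1 else 0)"
    proof (cases "i = j")
      case False
      thus ?thesis using corthogonalD[OF gs(2)] ij len by auto
    next
      case True
      define x where "x = Re (ws ! i \<bullet>c ws ! i)"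
      have "ws ! i \<bullet>c ws ! i \<noteq> 0" using corthogonalD[OF gs(2), of i i] ij len by auto
      hence "x > 0" using cscalar_prod_self_nonneg[of "ws ! i"] 
        by (auto simp: x_def cscalar_prod_self less_le simp del: of_real_sum)
      moreover have "ws ! i \<bullet>c ws ! i = of_real x" by (simp add: x_def cscalar_prod_self)
      ultimately show ?thesis using True 
        by (simp add: r_def x_def[symmetric] flip: of_real_mult)
    qed
    finally show "(mat_adjoint W * W) $$ (i, j) = 1\<^sub>m n $$ (i, j)" using ij by simp
  qed (use W in auto)
  moreover have "col W 0 = r 0 \<cdot>\<^sub>v v"
  proof -
    have "ws \<noteq> []" using n len by auto
    hence "ws ! 0 = v" using hdws by (simp add: hd_conv_nth)
    thus ?thesis using n v by (intro eq_vecI) (auto simp: W_def)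
  qed
  ultimately show ?thesis using that W by blast
qed

lemma unitary_inverse:
  fixes U :: "complex mat"
  assumes "U \<in> carrier_mat n n" "mat_adjoint U * U = 1\<^sub>m n"
  shows "U * mat_adjoint U = 1\<^sub>m n"
  using mat_mult_left_right_inverse[OF adjoint_carrier[OF assms(1)] assms] .

text \<open>Deflation: with an eigenvector as first column of a unitary \<open>W\<close>, the first
  column of the conjugated matrix is zero below the diagonal, and Hermiticity clears the first row
  too. What remains is a Hermitian block of one dimension less. That the entries of \<open>d\<close>
  are real is not part of the claim; it is derived later where it matters.\<close>

lemma hermitian_spectral:
  fixes A :: "complex mat"
  assumes "A \<in> carrier_mat n n" "mat_adjoint A = A"
  shows "\<exists>U d. U \<in> carrier_mat n n \<and> mat_adjoint U * U = 1\<^sub>m n \<and> mat_adjoint U * A * U = mat_diag n d"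
  using assms
proof (induction n arbitrary: A)
  case 0
  thus ?case by (intro exI[of _ "1\<^sub>m 0"] exI conjI eq_matI) (auto simp: mat_diag_def)
next
  case (Suc n)
  note A = Suc.prems(1)
  from char_poly_factorized[OF A] obtain as where
    as: "char_poly A = (\<Prod>a\<leftarrow>as. [:- a, 1:])" "length as = Suc n" by auto
  then obtain e where "poly (char_poly A) e = 0" by (cases as) auto
  then obtain v where ev: "eigenvector A v e"
    using eigenvalue_root_char_poly[OF A] by (auto simp: eigenvalue_def)
  hence v: "v \<in> carrier_vec (Suc n)" "v \<noteq> 0\<^sub>v (Suc n)" "A *\<^sub>v v = e \<cdot>\<^sub>v v"
    using A by (auto simp: eigenvector_def)
  obtain W c where W: "W \<in> carrier_mat (Suc n) (Suc n)" "mat_adjoint W * W = 1\<^sub>m (Suc n)"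
    and col: "col W 0 = c \<cdot>\<^sub>v v"
    using unitary_extension[OF v(1,2)] by blast
  define A' where "A' = mat_adjoint W * A * W"
  have W': "mat_adjoint W \<in> carrier_mat (Suc n) (Suc n)" using W by simp
  have A': "A' \<in> carrier_mat (Suc n) (Suc n)" using W A by (auto simp: A'_def)
  have herm: "mat_adjoint A' = A'"
    using W A W' unfolding A'_def
    by (simp add: adjoint_mult[of _ "Suc n" "Suc n" _ "Suc n"] Suc.prems(2) mult_carrier_mat[of _ "Suc n" "Suc n" _ "Suc n"] assoc_mult_mat[of _ "Suc n" "Suc n" _ "Suc n" _ "Suc n"])
  have col0: "A' $$ (i, 0) = (if i = 0 then e else 0)" if i: "i < Suc n" for i
  proof -
    have "A' = mat_adjoint W * (A * W)" unfolding A'_def by (rule assoc_mult_mat[OF W' A W(1)])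
    hence "A' $$ (i, 0) = row (mat_adjoint W) i \<bullet> col (A * W) 0" using i W A by simp
    also have "col (A * W) 0 = A *\<^sub>v col W 0" by (rule col_mult2[OF A W(1)]) simp
    also have "\<dots> = e \<cdot>\<^sub>v col W 0" unfolding col using v A by (simp add: mult_mat_vec smult_smult_assoc mult.commute)
    also have "row (mat_adjoint W) i \<bullet> (e \<cdot>\<^sub>v col W 0) = e * (row (mat_adjoint W) i \<bullet> col W 0)"
      using W i by simp
    also have "row (mat_adjoint W) i \<bullet> col W 0 = (mat_adjoint W * W) $$ (i, 0)" using i W(1) by simp
    finally show ?thesis using i W by simp
  qed
  have row0: "A' $$ (0, i) = (if i = 0 then e else 0)" if i: "i < Suc n" for i
  proof -
    have "A' $$ (0, i) = cnj (A' $$ (i, 0))" 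
      by (subst herm[symmetric]) (use A' i in auto)
    also have "A' $$ (i, 0) = (if i = 0 then A' $$ (0, 0) else 0)" using col0[OF i] col0[of 0] by simp
    also have "cnj \<dots> = (if i = 0 then e else 0)"
    proof -
      have "cnj (A' $$ (0, 0)) = A' $$ (0, 0)" using herm A' by (metis adjoint_index carrier_matD zero_less_Suc)
      thus ?thesis using col0[of 0] by simp
    qed
    finally show ?thesis .
  qed
  define A3 where "A3 = mat n n (\<lambda>(i, j). A' $$ (Suc i, Suc j))"
  have "A3 \<in> carrier_mat n n" by (simp add: A3_def)
  moreover have "mat_adjoint A3 = A3"
  proof (rule eq_matI)
    fix i j assume "i < dim_row A3" "j < dim_col A3"
    hence ij: "i < n" "j < n" by (auto simp: A3_def)
    have "cnj (A' $$ (Suc j, Suc i)) = mat_adjoint A' $$ (Suc i, Suc j)" using A' ij by simp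
    thus "mat_adjoint A3 $$ (i, j) = A3 $$ (i, j)" using ij herm by (simp add: A3_def)
  qed (auto simp: A3_def)
  ultimately obtain P d where P: "P \<in> carrier_mat n n" "mat_adjoint P * P = 1\<^sub>m n"
    "mat_adjoint P * A3 * P = mat_diag n d" using Suc.IH by blast
  have A3: "A3 \<in> carrier_mat n n" by (simp add: A3_def)
  define E where "E = four_block_mat (mat 1 1 (\<lambda>_. e)) (0\<^sub>m 1 n) (0\<^sub>m n 1) A3"
  define Q where "Q = four_block_mat (1\<^sub>m 1) (0\<^sub>m 1 n) (0\<^sub>m n 1) P"
  have A'E: "A' = E"
  proof (rule eq_matI)
    fix i j assume "i < dim_row E" "j < dim_col E"
    hence "i < Suc n" "j < Suc n" by (auto simp: E_def A3_def)
    thus "A' $$ (i, j) = E $$ (i, j)"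
      using col0[of i] row0[of j] by (cases i; cases j) (auto simp: E_def A3_def)
  qed (use A' in \<open>auto simp: E_def A3_def\<close>)
  have Q: "Q \<in> carrier_mat (Suc n) (Suc n)" using P by (auto simp: Q_def)
  have Q': "mat_adjoint Q = four_block_mat (1\<^sub>m 1) (0\<^sub>m 1 n) (0\<^sub>m n 1) (mat_adjoint P)"
    using P(1) Q by (intro eq_matI) (auto simp: Q_def)
  have QQ: "mat_adjoint Q * Q = 1\<^sub>m (Suc n)"
  proof -
    have "mat_adjoint Q * Q = four_block_mat (1\<^sub>m 1) (0\<^sub>m 1 n) (0\<^sub>m n 1) (1\<^sub>m n)"
      unfolding Q' unfolding Q_def
      by (subst mult_four_block_mat[of _ 1 1 _ n _ n _ _ 1 _ n]) (use P in auto)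
    also have "\<dots> = 1\<^sub>m (Suc n)" by (intro eq_matI) auto
    finally show ?thesis .
  qed
  have QEQ: "mat_adjoint Q * E * Q = mat_diag (Suc n) (case_nat e d)"
  proof -
    have "mat_adjoint Q * E = four_block_mat (mat 1 1 (\<lambda>_. e)) (0\<^sub>m 1 n) (0\<^sub>m n 1) (mat_adjoint P * A3)"
      unfolding Q' E_def
      by (subst mult_four_block_mat[of _ 1 1 _ n _ n _ _ 1 _ n]) (use P A3 in auto)
    hence "mat_adjoint Q * E * Q = four_block_mat (mat 1 1 (\<lambda>_. e)) (0\<^sub>m 1 n) (0\<^sub>m n 1)
        (mat_adjoint P * A3) * Q" by simp
    also have "\<dots> = four_block_mat (mat 1 1 (\<lambda>_. e)) (0\<^sub>m 1 n) (0\<^sub>m n 1) (mat_diag n d)"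
      unfolding Q_def P(3)[symmetric]
      by (subst mult_four_block_mat[of _ 1 1 _ n _ n _ _ 1 _ n]) (use P A3 in auto)
    also have "\<dots> = mat_diag (Suc n) (case_nat e d)"
      by (intro eq_matI) (auto simp: mat_diag_def split: nat.splits)
    finally show ?thesis .
  qed
  \<comment> \<open>\<open>W\<close> splits off the eigenvector, and \<open>Q\<close> acts as the
    identity on it while diagonalizing the remaining block.\<close>
  define U where "U = W * Q"
  have U: "U \<in> carrier_mat (Suc n) (Suc n)" using W Q by (simp add: U_def)
  have Qa: "mat_adjoint Q \<in> carrier_mat (Suc n) (Suc n)" using Q by simp
  note as = assoc_mult_mat[of _ "Suc n" "Suc n" _ "Suc n" _ "Suc n"] mult_carrier_mat[of _ "Suc n" "Suc n" _ "Suc n"]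
  have Ua: "mat_adjoint U = mat_adjoint Q * mat_adjoint W"
    unfolding U_def using W Q by (simp add: adjoint_mult[of _ "Suc n" "Suc n"])
  have "mat_adjoint U * U = mat_adjoint Q * (mat_adjoint W * W) * Q"
    unfolding Ua unfolding U_def using W(1) W' Q Qa by (simp add: as)
  hence "mat_adjoint U * U = 1\<^sub>m (Suc n)" using W Qa Q QQ by simp
  moreover have "mat_adjoint U * A * U = mat_adjoint Q * A' * Q"
    unfolding Ua unfolding U_def A'_def using W(1) W' Q Qa A by (simp add: as)
  ultimately show ?case using U QEQ A'E by metis
qed

subsection \<open>The spectral gap\<close>

text \<open>The choice operator in \<open>eig_mset\<close> is harmless: a product of monic linear
  factors determines their multiset, namely as its multiset of roots.\<close>

lemma eig_mset_unique:
  assumes "char_poly A = (\<Prod>a \<in># M. [:- a, 1:])"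
  shows "eig_mset A = M"
proof -
  have proots: "proots (\<Prod>a \<in># N. [:- a, 1:]) = N" for N :: "complex multiset"
    by (induction N) (simp_all add: proots_mult prod_mset_zero_iff image_iff del: mult_pCons_left)
  have "char_poly A = (\<Prod>a \<in># eig_mset A. [:- a, 1:])"
    unfolding eig_mset_def by (rule someI) (rule assms)
  thus ?thesis using assms proots by metis
qed

text \<open>In ascending order, the second largest entry is below \<open>t\<close> exactly when at
  most the last entry reaches \<open>t\<close>. The right-hand side compares indices and not values,
  so a repeated value counts as often as it occurs.\<close>

lemma second_largest_less_iff:
  fixes f :: "nat \<Rightarrow> real"
  assumes n: "n \<ge> 2"
  shows "sort (map f [0..<n]) ! (n - 2) < t \<longleftrightarrow> (\<forall>i<n. \<forall>j<n. t \<le> f i \<and> t \<le> f j \<longrightarrow> i = j)"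
proof -
  let ?xs = "sort (map f [0..<n])"
  \<comment> \<open>Equality of multisets would lose track of positions; the permutation ties each
    place in the sorted list to one index of \<open>f\<close>.\<close>
  obtain p where p: "p permutes {..<n}" "permute_list p (map f [0..<n]) = ?xs"
    using mset_eq_permutation[of ?xs "map f [0..<n]"] by auto
  have pin: "p k < n" if "k < n" for k using permutes_in_image[OF p(1)] that by auto
  have nth: "?xs ! k = f (p k)" if "k < n" for k
  proof -
    have "permute_list p (map f [0..<n]) ! k = f (p k)"
      using that p(1) pin by (subst permute_list_nth) auto
    thus ?thesis using p(2) by simp
  qed
  have inj: "p k = p l \<Longrightarrow> k = l" for k l using permutes_inj[OF p(1)] by (auto dest: injD)
  have surj: "\<exists>k<n. p k = i" if "i < n" for i
    using permutes_image[OF p(1)] that by (metis imageE lessThan_iff)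
  have mono: "?xs ! k \<le> ?xs ! l" if "k \<le> l" "l < n" for k l
    using sorted_nth_mono[of ?xs k l] that by simp
  show ?thesis
  proof
    assume less: "?xs ! (n - 2) < t"
    have "k = n - 1" if "k < n" "t \<le> ?xs ! k" for k
      using mono[of k "n - 2"] that less n by (cases "k \<le> n - 2") auto
    thus "\<forall>i<n. \<forall>j<n. t \<le> f i \<and> t \<le> f j \<longrightarrow> i = j"
      using surj nth by metis
  next
    assume uniq: "\<forall>i<n. \<forall>j<n. t \<le> f i \<and> t \<le> f j \<longrightarrow> i = j"
    show "?xs ! (n - 2) < t"
    proof (rule ccontr)
      assume "\<not> ?xs ! (n - 2) < t"
      moreover have "?xs ! (n - 2) \<le> ?xs ! (n - 1)" using mono n by simp
      ultimately have "t \<le> ?xs ! (n - 2)" "t \<le> ?xs ! (n - 1)" by linarith+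
      hence "p (n - 2) = p (n - 1)" using uniq nth pin n by simp
      thus False using inj n by fastforce
    qed
  qed
qed

lemma similar_diag_spectral_gap_pos_iff:
  assumes A: "A \<in> carrier_mat n n" and n: "n \<ge> 2"
    and U: "U \<in> carrier_mat n n" "mat_adjoint U * U = 1\<^sub>m n" "mat_adjoint U * A * U = mat_diag n d"
  shows "spectral_gap A > 0 \<longleftrightarrow> (\<forall>i<n. \<forall>j<n. 1 \<le> Re (d i) \<and> 1 \<le> Re (d j) \<longrightarrow> i = j)"
proof -
  have "similar_mat (mat_diag n d) A"
  proof -
    have "similar_mat_wit (mat_diag n d) A (mat_adjoint U) U"
      by (rule similar_mat_witI[of _ _ n]) (use U A unitary_inverse[OF U(1,2)] in auto)
    thus ?thesis unfolding similar_mat_def by blast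
  qed
  hence "char_poly A = char_poly (mat_diag n d)" by (simp add: char_poly_similar)
  also have "\<dots> = (\<Prod>a \<leftarrow> map d [0..<n]. [:- a, 1:])"
    by (subst char_poly_upper_triangular[of _ n]) (auto simp: mat_diag_def diag_mat_def o_def intro!: arg_cong[of _ _ prod_list])
  also have "\<dots> = (\<Prod>a \<in># mset (map d [0..<n]). [:- a, 1:])"
    by (metis mset_map prod_mset_prod_list)
  finally have "eig_mset A = mset (map d [0..<n])" by (rule eig_mset_unique)
  hence "sorted_list_of_multiset (image_mset Re (eig_mset A)) = sort (map (\<lambda>i. Re (d i)) [0..<n])"
    by (simp add: o_def flip: mset_map sorted_list_of_multiset_mset)
  thus ?thesis unfolding spectral_gap_def beta_def Let_def
    using second_largest_less_iff[OF n, of "\<lambda>i. Re (d i)" 1] by simp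
qed

text \<open>In eigenbasis coordinates, a fixed vector vanishes wherever the eigenvalue differs from
  1, and a positive gap leaves room for only one other index.\<close>

lemma spectral_gap_pos_imp_fixed_collinear:
  assumes A: "A \<in> carrier_mat n n" "mat_adjoint A = A" and n: "n \<ge> 2"
    and gap: "spectral_gap A > 0"
    and x: "x \<in> carrier_vec n" "A *\<^sub>v x = x"
    and y: "y \<in> carrier_vec n" "A *\<^sub>v y = y" "y \<noteq> 0\<^sub>v n"
  shows "\<exists>c. x = c \<cdot>\<^sub>v y"
proof -
  obtain U d where U: "U \<in> carrier_mat n n" "mat_adjoint U * U = 1\<^sub>m n" "mat_adjoint U * A * U = mat_diag n d"
    using hermitian_spectral[OF A] by blast
  note uniq = gap[unfolded similar_diag_spectral_gap_pos_iff[OF A(1) n U]]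
  have Ua: "mat_adjoint U \<in> carrier_mat n n" using U by simp
  have recover: "U *\<^sub>v (mat_adjoint U *\<^sub>v z) = z" if "z \<in> carrier_vec n" for z
    using that Ua U(1) unitary_inverse[OF U(1,2)] by (metis assoc_mult_mat_vec one_mult_mat_vec)
  have coord: "d i * (mat_adjoint U *\<^sub>v z) $ i = (mat_adjoint U *\<^sub>v z) $ i"
    if z: "z \<in> carrier_vec n" "A *\<^sub>v z = z" and i: "i < n" for z i
  proof -
    have w: "mat_adjoint U *\<^sub>v z \<in> carrier_vec n" using Ua z by simp
    have "mat_diag n d *\<^sub>v (mat_adjoint U *\<^sub>v z) = mat_adjoint U *\<^sub>v (A *\<^sub>v (U *\<^sub>v (mat_adjoint U *\<^sub>v z)))"
      unfolding U(3)[symmetric] using U(1) A Ua w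
      by (simp add: assoc_mult_mat_vec[of _ n n _ n] mult_carrier_mat[of _ n n _ n])
    hence "mat_diag n d *\<^sub>v (mat_adjoint U *\<^sub>v z) = mat_adjoint U *\<^sub>v z"
      using recover z by simp
    hence "(mat_diag n d *\<^sub>v (mat_adjoint U *\<^sub>v z)) $ i = (mat_adjoint U *\<^sub>v z) $ i" by simp
    moreover have "(mat_diag n d *\<^sub>v w) $ i = d i * w $ i" if "w \<in> carrier_vec n" for w
    proof -
      have "(mat_diag n d *\<^sub>v w) $ i = (\<Sum>j<n. (if i = j then d i * w $ i else 0))"
        unfolding mult_vec_index_sum[OF mat_diag_dim that i]
        by (intro sum.cong) (use i in \<open>auto simp: mat_diag_def\<close>)
      also have "\<dots> = d i * w $ i" using i by simp
      finally show ?thesis .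
    qed
    ultimately show ?thesis using w by simp
  qed
  let ?x = "mat_adjoint U *\<^sub>v x" and ?y = "mat_adjoint U *\<^sub>v y"
  have xy: "?x \<in> carrier_vec n" "?y \<in> carrier_vec n" using Ua x y by auto
  have "?y \<noteq> 0\<^sub>v n"
  proof
    assume "?y = 0\<^sub>v n"
    hence "U *\<^sub>v ?y = 0\<^sub>v n" using U by (intro eq_vecI) auto
    thus False using recover y by simp
  qed
  \<comment> \<open>A nonzero fixed vector exhibits an index with eigenvalue 1; by
    \<open>uniq\<close> it is the only such index, so both vectors are supported there.\<close>
  then obtain i where i: "i < n" "?y $ i \<noteq> 0" using xy by (metis carrier_vecD eq_vecI index_zero_vec)
  hence di: "d i = 1" using coord[OF y(1,2) i(1)] by simp
  have other: "?x $ j = 0" "?y $ j = 0" if "j < n" "j \<noteq> i" for j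
  proof -
    have "d j \<noteq> 1" using uniq i di that by force
    thus "?x $ j = 0" "?y $ j = 0" using coord[OF x that(1)] coord[OF y(1,2) that(1)] by auto
  qed
  define c where "c = ?x $ i / ?y $ i"
  have "?x = c \<cdot>\<^sub>v ?y"
  proof (rule eq_vecI)
    fix j assume "j < dim_vec (c \<cdot>\<^sub>v ?y)"
    hence j: "j < n" using U by simp
    have "?x $ j = c * ?y $ j" using other[OF j] i by (cases "j = i") (auto simp: c_def)
    thus "?x $ j = (c \<cdot>\<^sub>v ?y) $ j" using j U by simp
  qed (use U in auto)
  hence "U *\<^sub>v ?x = c \<cdot>\<^sub>v (U *\<^sub>v ?y)" using mult_mat_vec[OF U(1) xy(2)] by simp
  thus ?thesis using recover x y by auto
qed

text \<open>The bound on the quadratic form is what makes fixed vectors decisive: it excludes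
  eigenvalues above 1, so every eigenvalue that threatens the gap is equal to 1 and its eigenvector
  is fixed.\<close>

lemma fixed_collinear_imp_spectral_gap_pos:
  assumes A: "A \<in> carrier_mat n n" "mat_adjoint A = A" and n: "n \<ge> 2"
    and le1: "\<And>v. v \<in> carrier_vec n \<Longrightarrow> Re ((A *\<^sub>v v) \<bullet>c v) \<le> Re (v \<bullet>c v)"
    and y: "y \<in> carrier_vec n"
    and coll: "\<And>x. x \<in> carrier_vec n \<Longrightarrow> A *\<^sub>v x = x \<Longrightarrow> \<exists>c. x = c \<cdot>\<^sub>v y"
  shows "spectral_gap A > 0"
proof -
  obtain U d where U: "U \<in> carrier_mat n n" "mat_adjoint U * U = 1\<^sub>m n" "mat_adjoint U * A * U = mat_diag n d"
    using hermitian_spectral[OF A] by blast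
  have Ua: "mat_adjoint U \<in> carrier_mat n n" using U by simp
  have "A * U = U * mat_diag n d"
  proof -
    have "U * mat_diag n d = (U * mat_adjoint U) * (A * U)"
      unfolding U(3)[symmetric] using U(1) A Ua
      by (simp add: assoc_mult_mat[of _ n n _ n _ n] mult_carrier_mat[of _ n n _ n])
    thus ?thesis using unitary_inverse[OF U(1,2)] U A by simp
  qed
  have eig: "A *\<^sub>v col U i = d i \<cdot>\<^sub>v col U i" if i: "i < n" for i
  proof -
    have "A *\<^sub>v col U i = col (A * U) i" by (rule col_mult2[OF A(1) U(1) i, symmetric])
    also have "\<dots> = d i \<cdot>\<^sub>v col U i"
      unfolding \<open>A * U = _\<close> mat_diag_mult_right[OF U(1)] 
      by (rule eq_vecI) (use U i in auto)
    finally show ?thesis .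
  qed
  have colU: "col U i \<in> carrier_vec n" if "i < n" for i using U that by simp
  have orth: "col U i \<bullet>c col U j = (if i = j then 1 else 0)" if "i < n" "j < n" for i j
  proof -
    have "col U i \<bullet>c col U j = (mat_adjoint U * U) $$ (j, i)"
      using U(1) that by (subst mult_mat_index_sum[of _ n n _ n]) (auto simp: cscalar_prod_sum mult.commute)
    thus ?thesis using U(2) that by simp
  qed
  have fixed: "A *\<^sub>v col U i = col U i" if i: "i < n" "1 \<le> Re (d i)" for i
  proof -
    \<comment> \<open>On a unit eigenvector the quadratic form is the eigenvalue itself. The bound
      caps its real part at 1, and Hermiticity removes the imaginary part.\<close>
    have di: "(A *\<^sub>v col U i) \<bullet>c col U i = d i"
      unfolding eig[OF i(1)] using orth[OF i(1) i(1)] colU[OF i(1)] by simp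
    have "Re (d i) \<le> 1" using le1[OF colU[OF i(1)]] orth[OF i(1) i(1)] unfolding di by simp
    moreover have "cnj (d i) = d i"
      unfolding di[symmetric] using colU[OF i(1)] A
      by (subst (2) cscalar_prod_adjoint[OF A(1)]) (auto intro!: cscalar_prod_commute[symmetric])
    ultimately have "d i = 1" using i by (auto simp: complex_eq_iff)
    thus ?thesis using eig[OF i(1)] by simp
  qed
  have "i = j" if ij: "i < n" "j < n" "1 \<le> Re (d i)" "1 \<le> Re (d j)" for i j
  proof (rule ccontr)
    assume "i \<noteq> j"
    obtain a where a: "col U i = a \<cdot>\<^sub>v y" using coll[OF colU fixed] ij by blast
    obtain b where b: "col U j = b \<cdot>\<^sub>v y" using coll[OF colU fixed] ij by blast
    \<comment> \<open>The two normalizations make \<open>a\<close>, \<open>b\<close> and the squared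
      norm of \<open>y\<close> nonzero, whereas orthogonality makes their product vanish.\<close>
    have "a * cnj a * (y \<bullet>c y) = 1" using orth[of i i] ij y unfolding a by (simp add: conjugate_smult_vec mult_ac)
    moreover have "b * cnj b * (y \<bullet>c y) = 1" using orth[of j j] ij y unfolding b by (simp add: conjugate_smult_vec mult_ac)
    moreover have "a * cnj b * (y \<bullet>c y) = 0" using orth[of i j] ij y \<open>i \<noteq> j\<close> unfolding a b by (simp add: conjugate_smult_vec mult_ac)
    ultimately show False by auto
  qed
  thus ?thesis unfolding similar_diag_spectral_gap_pos_iff[OF A(1) n U] by blast
qed

subsection \<open>Projections and resolutions of the identity\<close>

definition projection :: "nat \<Rightarrow> complex mat \<Rightarrow> bool" where
  "projection n P \<longleftrightarrow> P \<in> carrier_mat n n \<and> mat_adjoint P = P \<and> P * P = P"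

text \<open>Vectors of all lengths share one type, so the length \<open>n\<close> is passed
  explicitly; even an empty sum then has the right dimension.\<close>

definition vec_sum :: "nat \<Rightarrow> ('i \<Rightarrow> complex vec) \<Rightarrow> 'i set \<Rightarrow> complex vec" where
  "vec_sum n f I = vec n (\<lambda>r. \<Sum>i\<in>I. f i $ r)"

definition op_sum :: "nat \<Rightarrow> ('i \<Rightarrow> complex mat) \<Rightarrow> 'i set \<Rightarrow> complex mat" where
  "op_sum n f I = mat n n (\<lambda>rc. \<Sum>i\<in>I. f i $$ rc)"

lemma vec_sum_carrier [simp]: "vec_sum n f I \<in> carrier_vec n"
  by (simp add: vec_sum_def)

lemma op_sum_carrier [simp]: "op_sum n f I \<in> carrier_mat n n"
  by (simp add: op_sum_def)

lemma op_sum_dim [simp]: "dim_row (op_sum n f I) = n" "dim_col (op_sum n f I) = n"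
  by (simp_all add: op_sum_def)

lemma vec_sum_dim [simp]: "dim_vec (vec_sum n f I) = n"
  by (simp add: vec_sum_def)

lemma vec_sum_cong: "(\<And>i. i \<in> I \<Longrightarrow> f i = g i) \<Longrightarrow> vec_sum n f I = vec_sum n g I"
  by (simp add: vec_sum_def)

lemma op_sum_cong: "(\<And>i. i \<in> I \<Longrightarrow> f i = g i) \<Longrightarrow> op_sum n f I = op_sum n g I"
  by (simp add: op_sum_def)

lemma vec_sum_single:
  assumes "finite I" "i \<in> I" "f i \<in> carrier_vec n" "\<And>j. j \<in> I \<Longrightarrow> j \<noteq> i \<Longrightarrow> f j = 0\<^sub>v n"
  shows "vec_sum n f I = f i"
proof (rule eq_vecI)
  fix r assume "r < dim_vec (f i)"
  hence r: "r < n" using assms by simp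
  have "(\<Sum>j\<in>I. f j $ r) = (\<Sum>j\<in>I. if j = i then f i $ r else 0)"
    by (rule sum.cong) (use assms(4) r in auto)
  thus "vec_sum n f I $ r = f i $ r" using r assms by (simp add: vec_sum_def)
qed (use assms in auto)

lemma vec_sum_zero: "(\<And>i. i \<in> I \<Longrightarrow> f i = 0\<^sub>v n) \<Longrightarrow> vec_sum n f I = 0\<^sub>v n"
  by (rule eq_vecI) (auto simp: vec_sum_def)

lemma op_sum_mult_vec:
  assumes "\<And>i. i \<in> I \<Longrightarrow> f i \<in> carrier_mat n n" "v \<in> carrier_vec n"
  shows "op_sum n f I *\<^sub>v v = vec_sum n (\<lambda>i. f i *\<^sub>v v) I"
proof (rule eq_vecI)
  fix r assume "r < dim_vec (vec_sum n (\<lambda>i. f i *\<^sub>v v) I)"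
  hence r: "r < n" by simp
  have "(op_sum n f I *\<^sub>v v) $ r = (\<Sum>c<n. \<Sum>i\<in>I. f i $$ (r, c) * v $ c)"
    using r by (subst mult_vec_index_sum[OF op_sum_carrier assms(2) r]) (simp add: op_sum_def sum_distrib_right)
  also have "\<dots> = (\<Sum>i\<in>I. \<Sum>c<n. f i $$ (r, c) * v $ c)" by (rule sum.swap)
  also have "\<dots> = (\<Sum>i\<in>I. (f i *\<^sub>v v) $ r)"
    by (intro sum.cong refl mult_vec_index_sum[symmetric, OF _ assms(2) r] assms(1))
  finally show "(op_sum n f I *\<^sub>v v) $ r = vec_sum n (\<lambda>i. f i *\<^sub>v v) I $ r"
    using r by (simp add: vec_sum_def)
qed simp

lemma mult_mat_vec_sum:
  assumes "A \<in> carrier_mat m n" "\<And>i. i \<in> I \<Longrightarrow> f i \<in> carrier_vec n"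
  shows "A *\<^sub>v vec_sum n f I = vec_sum m (\<lambda>i. A *\<^sub>v f i) I"
proof (rule eq_vecI)
  fix r assume "r < dim_vec (vec_sum m (\<lambda>i. A *\<^sub>v f i) I)"
  hence r: "r < m" by simp
  have "(A *\<^sub>v vec_sum n f I) $ r = (\<Sum>c<n. \<Sum>i\<in>I. A $$ (r, c) * f i $ c)"
    using r by (subst mult_vec_index_sum[OF assms(1) vec_sum_carrier r]) (simp add: vec_sum_def sum_distrib_left)
  also have "\<dots> = (\<Sum>i\<in>I. \<Sum>c<n. A $$ (r, c) * f i $ c)" by (rule sum.swap)
  also have "\<dots> = (\<Sum>i\<in>I. (A *\<^sub>v f i) $ r)"
    by (intro sum.cong refl mult_vec_index_sum[symmetric, OF assms(1) _ r] assms(2))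
  finally show "(A *\<^sub>v vec_sum n f I) $ r = vec_sum m (\<lambda>i. A *\<^sub>v f i) I $ r"
    using r by (simp add: vec_sum_def)
qed (use assms in simp)

lemma vec_sum_cscalar_prod:
  assumes "w \<in> carrier_vec n"
  shows "vec_sum n f I \<bullet>c w = (\<Sum>i\<in>I. f i \<bullet>c w)"
proof -
  have "vec_sum n f I \<bullet>c w = (\<Sum>r<n. \<Sum>i\<in>I. f i $ r * cnj (w $ r))"
    using assms by (simp add: cscalar_prod_sum vec_sum_def sum_distrib_right)
  also have "\<dots> = (\<Sum>i\<in>I. \<Sum>r<n. f i $ r * cnj (w $ r))" by (rule sum.swap)
  finally show ?thesis using assms by (simp add: cscalar_prod_sum)
qed

lemma projection_mult_vec_twice:
  assumes "projection n P" "v \<in> carrier_vec n"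
  shows "P *\<^sub>v (P *\<^sub>v v) = P *\<^sub>v v"
  using assms unfolding projection_def by (metis assoc_mult_mat_vec)

lemma projection_cscalar_prod:
  assumes "projection n P" "v \<in> carrier_vec n"
  shows "(P *\<^sub>v v) \<bullet>c v = (P *\<^sub>v v) \<bullet>c (P *\<^sub>v v)"
proof -
  have P: "P \<in> carrier_mat n n" "mat_adjoint P = P" using assms by (auto simp: projection_def)
  have "(P *\<^sub>v v) \<bullet>c (P *\<^sub>v v) = (P *\<^sub>v (P *\<^sub>v v)) \<bullet>c v"
    using P assms(2) by (subst (2) cscalar_prod_adjoint[of _ n n]) auto
  thus ?thesis using projection_mult_vec_twice[OF assms] by simp
qed

lemma projection_imp_psd: "projection n P \<Longrightarrow> psd n P"
  using projection_cscalar_prod[of n P] cscalar_prod_self_nonneg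
  by (auto simp: psd_def projection_def)

lemma projection_complement:
  assumes "projection n P"
  shows "projection n (1\<^sub>m n - P)"
proof -
  have P: "P \<in> carrier_mat n n" "mat_adjoint P = P" "P * P = P" using assms by (auto simp: projection_def)
  have "(1\<^sub>m n - P) * (1\<^sub>m n - P) = 1\<^sub>m n * (1\<^sub>m n - P) - P * (1\<^sub>m n - P)"
    using P by (intro minus_mult_distrib_mat[of _ n n _ _ n]) auto
  also have "P * (1\<^sub>m n - P) = P * 1\<^sub>m n - P * P"
    using P by (intro mult_minus_distrib_mat[of _ n n _ n]) auto
  finally have "(1\<^sub>m n - P) * (1\<^sub>m n - P) = 1\<^sub>m n - P"
    using P by (auto intro!: eq_matI)
  thus ?thesis using P adjoint_minus[of "1\<^sub>m n" n n P] by (simp add: projection_def minus_carrier_mat)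
qed

lemma is_test_projection_iff:
  assumes "projection n E"
  shows "is_test n \<Psi> E \<longleftrightarrow> E *\<^sub>v \<Psi> = \<Psi>"
  using assms projection_complement projection_imp_psd by (auto simp: is_test_def)

lemma projection_op_sum:
  assumes fin: "finite I" and proj: "\<And>i. i \<in> I \<Longrightarrow> projection n (f i)"
    and orth: "\<And>i j. i \<in> I \<Longrightarrow> j \<in> I \<Longrightarrow> i \<noteq> j \<Longrightarrow> f i * f j = 0\<^sub>m n n"
  shows "projection n (op_sum n f I)"
proof -
  have f: "f i \<in> carrier_mat n n" "mat_adjoint (f i) = f i" if "i \<in> I" for i
    using proj[OF that] by (auto simp: projection_def)
  have "mat_adjoint (op_sum n f I) = op_sum n f I"
  proof (rule eq_matI)
    fix r c assume rc: "r < dim_row (op_sum n f I)" "c < dim_col (op_sum n f I)"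
    have "cnj (f i $$ (c, r)) = f i $$ (r, c)" if "i \<in> I" for i
      using f[OF that] rc by (metis adjoint_index carrier_matD op_sum_dim)
    thus "mat_adjoint (op_sum n f I) $$ (r, c) = op_sum n f I $$ (r, c)" using rc by (simp add: op_sum_def)
  qed auto
  moreover have "op_sum n f I * op_sum n f I = op_sum n f I"
  proof (rule mat_eq_by_mult_vec[of _ n n])
    fix v :: "complex vec" assume v: "v \<in> carrier_vec n"
    have fv: "f i *\<^sub>v v \<in> carrier_vec n" if "i \<in> I" for i using f[OF that] v by simp
    have "f i *\<^sub>v vec_sum n (\<lambda>i. f i *\<^sub>v v) I = f i *\<^sub>v v" if i: "i \<in> I" for i
    proof -
      have "f i *\<^sub>v (f j *\<^sub>v v) = 0\<^sub>v n" if "j \<in> I" "j \<noteq> i" for j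
        using orth[OF i that(1)] that f[OF that(1)] f[OF i] v
        by (subst assoc_mult_mat_vec[symmetric, of _ n n _ n]) auto
      moreover have "f i *\<^sub>v (f i *\<^sub>v v) = f i *\<^sub>v v" by (rule projection_mult_vec_twice[OF proj[OF i] v])
      ultimately show ?thesis
        using f i fv by (subst mult_mat_vec_sum[of _ n n]) (auto intro!: vec_sum_single[OF fin i, THEN trans])
    qed
    hence "op_sum n f I *\<^sub>v (op_sum n f I *\<^sub>v v) = op_sum n f I *\<^sub>v v"
      using f v by (simp add: op_sum_mult_vec cong: vec_sum_cong)
    thus "op_sum n f I * op_sum n f I *\<^sub>v v = op_sum n f I *\<^sub>v v"
      using v by (subst assoc_mult_mat_vec[of _ n n _ n]) auto
  qed auto
  ultimately show ?thesis by (simp add: projection_def)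
qed

text \<open>Unlike \<open>proj_meas\<close>, this records pairwise orthogonality, which allows a sum
  over accepted outcomes to be analysed one outcome at a time.\<close>

definition resolution :: "nat \<Rightarrow> ('i \<Rightarrow> complex mat) \<Rightarrow> 'i set \<Rightarrow> bool" where
  "resolution n f I \<longleftrightarrow> finite I \<and> (\<forall>i\<in>I. projection n (f i)) \<and>
     (\<forall>i\<in>I. \<forall>j\<in>I. i \<noteq> j \<longrightarrow> f i * f j = 0\<^sub>m n n) \<and> op_sum n f I = 1\<^sub>m n"

lemma resolution_op_sum_projection:
  assumes "resolution n f I" "J \<subseteq> I"
  shows "projection n (op_sum n f J)"
  using assms by (intro projection_op_sum) (auto simp: resolution_def intro: finite_subset)

text \<open>Passing with certainty means that no rejected outcome can occur. A rejected projection
  annihilates every accepted component; conversely, if the rejected components of \<open>v\<close>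
  vanish, the accepted ones already add up to \<open>v\<close>.\<close>

lemma resolution_fixed_iff:
  assumes res: "resolution n f I" and J: "J \<subseteq> I" and v: "v \<in> carrier_vec n"
  shows "op_sum n f J *\<^sub>v v = v \<longleftrightarrow> (\<forall>i\<in>I - J. f i *\<^sub>v v = 0\<^sub>v n)"
proof
  have f: "f i \<in> carrier_mat n n" if "i \<in> I" for i
    using res that by (auto simp: resolution_def projection_def)
  have finJ: "finite J" "finite I" using res J by (auto simp: resolution_def intro: finite_subset)
  {
    assume fixed: "op_sum n f J *\<^sub>v v = v"
    show "\<forall>i\<in>I - J. f i *\<^sub>v v = 0\<^sub>v n"
    proof
      fix i assume i: "i \<in> I - J"
      have "f i *\<^sub>v v = f i *\<^sub>v vec_sum n (\<lambda>j. f j *\<^sub>v v) J"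
        using fixed op_sum_mult_vec[of J f n v] J f v by (metis subsetD)
      also have "\<dots> = vec_sum n (\<lambda>j. f i *\<^sub>v (f j *\<^sub>v v)) J"
        using i f J v by (subst mult_mat_vec_sum[of _ n n]) (auto intro!: mult_mat_vec_carrier)
      also have "\<dots> = 0\<^sub>v n"
      proof (rule vec_sum_zero)
        fix j assume j: "j \<in> J"
        hence "j \<in> I" "i \<in> I" "i \<noteq> j" using i J by auto
        hence "f i * f j = 0\<^sub>m n n" using res unfolding resolution_def by blast
        thus "f i *\<^sub>v (f j *\<^sub>v v) = 0\<^sub>v n"
          using f i j J v by (subst assoc_mult_mat_vec[symmetric, of _ n n _ n]) auto
      qed
      finally show "f i *\<^sub>v v = 0\<^sub>v n" .
    qed
  }
  assume zero: "\<forall>i\<in>I - J. f i *\<^sub>v v = 0\<^sub>v n"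
  have "op_sum n f J *\<^sub>v v = vec_sum n (\<lambda>i. f i *\<^sub>v v) J"
    using f J v by (intro op_sum_mult_vec) auto
  also have "\<dots> = vec_sum n (\<lambda>i. f i *\<^sub>v v) I"
  proof (rule eq_vecI)
    fix r assume "r < dim_vec (vec_sum n (\<lambda>i. f i *\<^sub>v v) I)"
    moreover have "(\<Sum>i\<in>J. (f i *\<^sub>v v) $ r) = (\<Sum>i\<in>I. (f i *\<^sub>v v) $ r)" if "r < n"
      by (rule sum.mono_neutral_left) (use finJ J zero that in auto)
    ultimately show "vec_sum n (\<lambda>i. f i *\<^sub>v v) J $ r = vec_sum n (\<lambda>i. f i *\<^sub>v v) I $ r"
      by (simp add: vec_sum_def)
  qed simp
  also have "\<dots> = op_sum n f I *\<^sub>v v"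
    using f v by (intro op_sum_mult_vec[symmetric]) auto
  also have "\<dots> = v" using res v by (simp add: resolution_def)
  finally show "op_sum n f J *\<^sub>v v = v" .
qed

section \<open>Lists of projectors and resolutions of the identity\<close>

lemma foldr_add_index:
  fixes Ps :: "complex mat list"
  assumes "\<And>P. P \<in> set Ps \<Longrightarrow> P \<in> carrier_mat n n"
  shows "foldr (+) Ps (0\<^sub>m n n) = op_sum n ((!) Ps) {..<length Ps}"
  using assms
proof (induction Ps)
  case Nil
  show ?case by (rule eq_matI) (auto simp: op_sum_def)
next
  case (Cons P Ps)
  hence "foldr (+) (P # Ps) (0\<^sub>m n n) = P + op_sum n ((!) Ps) {..<length Ps}" by simp
  also have "\<dots> = op_sum n ((!) (P # Ps)) {..<length (P # Ps)}"
    using Cons.prems[of P] by (intro eq_matI) (auto simp: op_sum_def sum.lessThan_Suc_shift simp del: sum.lessThan_Suc)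
  finally show ?case .
qed

text \<open>Orthogonality is automatic: if \<open>w\<close> lies in the range of one projection, then the squared norms of
  the components of \<open>w\<close> sum to that of \<open>w\<close>, which this one projection already exhausts.\<close>

lemma proj_meas_imp_resolution:
  assumes "proj_meas n Ps"
  shows "resolution n ((!) Ps) {..<length Ps}"
proof -
  let ?I = "{..<length Ps}"
  have proj: "projection n (Ps ! i)" if "i \<in> ?I" for i
    using assms that by (auto simp: proj_meas_def projection_def)
  hence P: "Ps ! i \<in> carrier_mat n n" if "i \<in> ?I" for i using that by (auto simp: projection_def)
  have one: "op_sum n ((!) Ps) ?I = 1\<^sub>m n"
    using assms foldr_add_index[of Ps n] by (auto simp: proj_meas_def)
  have "Ps ! i * Ps ! j = 0\<^sub>m n n" if ij: "i \<in> ?I" "j \<in> ?I" "i \<noteq> j" for i j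
  proof (rule mat_eq_by_mult_vec[of _ n n])
    fix v :: "complex vec" assume v: "v \<in> carrier_vec n"
    define w where "w = Ps ! j *\<^sub>v v"
    have w: "w \<in> carrier_vec n" using v P[OF ij(2)] by (simp add: w_def)
    have fixed: "Ps ! j *\<^sub>v w = w" unfolding w_def by (rule projection_mult_vec_twice[OF proj[OF ij(2)] v])
    have "w = vec_sum n (\<lambda>k. Ps ! k *\<^sub>v w) ?I"
      using op_sum_mult_vec[of ?I "(!) Ps" n w] P w one by simp
    hence "w \<bullet>c w = (\<Sum>k\<in>?I. (Ps ! k *\<^sub>v w) \<bullet>c w)"
      using vec_sum_cscalar_prod[OF w] by metis
    also have "\<dots> = (\<Sum>k\<in>?I. (Ps ! k *\<^sub>v w) \<bullet>c (Ps ! k *\<^sub>v w))"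
      by (intro sum.cong refl projection_cscalar_prod[OF proj w])
    also have "\<dots> = w \<bullet>c w + (\<Sum>k\<in>?I - {j}. (Ps ! k *\<^sub>v w) \<bullet>c (Ps ! k *\<^sub>v w))"
      using ij by (subst sum.remove[of _ j]) (auto simp: fixed)
    finally have "(\<Sum>k\<in>?I - {j}. (Ps ! k *\<^sub>v w) \<bullet>c (Ps ! k *\<^sub>v w)) = 0"
      by (simp only: add_cancel_right_right)
    hence "(\<Sum>k\<in>?I - {j}. Re ((Ps ! k *\<^sub>v w) \<bullet>c (Ps ! k *\<^sub>v w))) = 0"
      by (metis Re_sum zero_complex.sel(1))
    hence "Re ((Ps ! i *\<^sub>v w) \<bullet>c (Ps ! i *\<^sub>v w)) = 0"
      using ij by (subst (asm) sum_nonneg_eq_0_iff) (auto intro: cscalar_prod_self_nonneg)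
    hence "Ps ! i *\<^sub>v w = 0\<^sub>v n" using cscalar_prod_self_eq_0[of "Ps ! i *\<^sub>v w" n] P[OF ij(1)] w by simp
    thus "Ps ! i * Ps ! j *\<^sub>v v = 0\<^sub>m n n *\<^sub>v v"
      using P[OF ij(1)] P[OF ij(2)] v unfolding w_def by (auto intro!: eq_vecI)
  qed (use P[OF ij(1)] P[OF ij(2)] in \<open>auto intro!: mult_carrier_mat\<close>)
  thus ?thesis using proj one by (simp add: resolution_def)
qed

text \<open>Schmidt vectors need not span, and some may be zero, so their projections are completed
  by one extra outcome. It is appended last, so the indices of the given projections stay
  unchanged.\<close>

lemma proj_meas_completion:
  assumes proj: "\<And>i. i < k \<Longrightarrow> projection n (f i)"
    and orth: "\<And>i j. i < k \<Longrightarrow> j < k \<Longrightarrow> i \<noteq> j \<Longrightarrow> f i * f j = 0\<^sub>m n n"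
  shows "proj_meas n (map f [0..<k] @ [1\<^sub>m n - op_sum n f {..<k}])"
proof -
  let ?Ps = "map f [0..<k] @ [1\<^sub>m n - op_sum n f {..<k}]"
  have "projection n (op_sum n f {..<k})" using assms by (intro projection_op_sum) auto
  hence all: "projection n P" if "P \<in> set ?Ps" for P using that proj projection_complement by auto
  have "foldr (+) ?Ps (0\<^sub>m n n) = op_sum n ((!) ?Ps) {..<Suc k}"
    by (subst foldr_add_index) (use all in \<open>auto simp: projection_def\<close>)
  also have "\<dots> = 1\<^sub>m n"
    by (rule eq_matI) (auto simp: op_sum_def nth_append)
  finally show ?thesis using all by (auto simp: proj_meas_def projection_def)
qed

lemma proj_meas_two:
  assumes "projection n P"
  shows "proj_meas n [P, 1\<^sub>m n - P]"
proof -
  have "op_sum n (\<lambda>_. P) {..<1::nat} = P"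
    using assms by (intro eq_matI) (auto simp: op_sum_def projection_def)
  thus ?thesis using proj_meas_completion[of 1 n "\<lambda>_. P"] assms by simp
qed

text \<open>The orthogonal projection onto the line of \<open>v\<close>. Dividing by the squared
  norm avoids normalizing \<open>v\<close>, and since division by 0 yields 0, the zero vector gives
  the zero projection. Vanishing Schmidt vectors thus need no separate treatment in the
  measurements.\<close>

definition rank_one :: "complex vec \<Rightarrow> complex mat" where
  "rank_one v = mat (dim_vec v) (dim_vec v) (\<lambda>(i, j). v $ i * cnj (v $ j) / (v \<bullet>c v))"

lemma rank_one_carrier [simp]: "v \<in> carrier_vec n \<Longrightarrow> rank_one v \<in> carrier_mat n n"
  by (auto simp: rank_one_def)

lemma rank_one_mult_vec:
  assumes "v \<in> carrier_vec n" "w \<in> carrier_vec n"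
  shows "rank_one v *\<^sub>v w = ((w \<bullet>c v) / (v \<bullet>c v)) \<cdot>\<^sub>v v"
proof (rule eq_vecI)
  fix i assume "i < dim_vec (((w \<bullet>c v) / (v \<bullet>c v)) \<cdot>\<^sub>v v)"
  hence i: "i < n" using assms by simp
  show "(rank_one v *\<^sub>v w) $ i = (((w \<bullet>c v) / (v \<bullet>c v)) \<cdot>\<^sub>v v) $ i"
    unfolding mult_vec_index_sum[OF rank_one_carrier[OF assms(1)] assms(2) i]
    using i assms by (simp add: rank_one_def cscalar_prod_sum[of w v] sum_divide_distrib sum_distrib_left sum_distrib_right mult_ac)
qed (use assms in \<open>auto simp: rank_one_def\<close>)

lemma rank_one_self:
  assumes "v \<in> carrier_vec n"
  shows "rank_one v *\<^sub>v v = v"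
proof (cases "v = 0\<^sub>v n")
  case True
  thus ?thesis using rank_one_mult_vec[OF assms assms] by (auto intro!: eq_vecI)
next
  case False
  hence "v \<bullet>c v \<noteq> 0" using assms by simp
  thus ?thesis using assms by (simp add: rank_one_mult_vec)
qed

lemma rank_one_projection:
  assumes v: "v \<in> carrier_vec n"
  shows "projection n (rank_one v)"
proof -
  have cn: "cnj (v \<bullet>c v) = v \<bullet>c v" by (simp add: cscalar_prod_self)
  have "mat_adjoint (rank_one v) = rank_one v"
    by (rule eq_matI) (auto simp: rank_one_def cn)
  moreover have "rank_one v * rank_one v = rank_one v"
  proof (rule mat_eq_by_mult_vec[of _ n n])
    fix w :: "complex vec" assume w: "w \<in> carrier_vec n"
    have "rank_one v * rank_one v *\<^sub>v w = rank_one v *\<^sub>v (rank_one v *\<^sub>v w)"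
      using v w by (intro assoc_mult_mat_vec[of _ n n _ n]) auto
    also have "\<dots> = rank_one v *\<^sub>v w"
      using v rank_one_self[OF v] by (simp add: rank_one_mult_vec[OF v w] mult_mat_vec[OF rank_one_carrier[OF v] v])
    finally show "rank_one v * rank_one v *\<^sub>v w = rank_one v *\<^sub>v w" .
  qed (use rank_one_carrier[OF v] in auto)
  ultimately show ?thesis using v by (simp add: projection_def)
qed

lemma rank_one_orthogonal:
  assumes u: "u \<in> carrier_vec n" and v: "v \<in> carrier_vec n" and "v \<bullet>c u = 0"
  shows "rank_one u * rank_one v = 0\<^sub>m n n"
proof (rule mat_eq_by_mult_vec[of _ n n])
  fix w :: "complex vec" assume w: "w \<in> carrier_vec n"
  have "rank_one u * rank_one v *\<^sub>v w = rank_one u *\<^sub>v (rank_one v *\<^sub>v w)"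
    using u v w by (intro assoc_mult_mat_vec[of _ n n _ n]) auto
  also have "\<dots> = ((w \<bullet>c v) / (v \<bullet>c v) * 0) \<cdot>\<^sub>v u"
    using u v assms(3) by (simp add: rank_one_mult_vec[OF v w] mult_mat_vec[OF rank_one_carrier[OF u] v] rank_one_mult_vec[OF u v] smult_smult_assoc)
  also have "\<dots> = 0\<^sub>m n n *\<^sub>v w" using u w by (intro eq_vecI) auto
  finally show "rank_one u * rank_one v *\<^sub>v w = 0\<^sub>m n n *\<^sub>v w" .
qed (use rank_one_carrier[OF u] rank_one_carrier[OF v] in auto)

subsection \<open>Tensor products\<close>

text \<open>Quotient and remainder decode the flattened index of a tensor product; all sums over the
  product space split into double sums this way.\<close>

lemma sum_div_mod:
  fixes f :: "nat \<Rightarrow> nat \<Rightarrow> complex"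
  shows "(\<Sum>k<m * n. f (k div n) (k mod n)) = (\<Sum>i<m. \<Sum>j<n. f i j)"
proof -
  have "(\<Sum>k<m * n. f (k div n) (k mod n)) = (\<Sum>i<m. \<Sum>k=i * n..<i * n + n. f (k div n) (k mod n))"
    by (rule sum.nat_group[symmetric])
  also have "\<dots> = (\<Sum>i<m. \<Sum>j<n. f i j)"
  proof (rule sum.cong[OF refl])
    fix i
    have "(\<Sum>k=i * n..<i * n + n. f (k div n) (k mod n)) = (\<Sum>j=0..<n. f ((j + i * n) div n) ((j + i * n) mod n))"
      using sum.shift_bounds_nat_ivl[of "\<lambda>k. f (k div n) (k mod n)" 0 "i * n" n] by (simp add: add.commute)
    thus "(\<Sum>k=i * n..<i * n + n. f (k div n) (k mod n)) = (\<Sum>j<n. f i j)"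
      by (simp add: atLeast0LessThan)
  qed
  finally show ?thesis .
qed

lemma div_mod_less:
  assumes "(r :: nat) < m * n"
  shows "r div n < m" "r mod n < n"
proof -
  have "n > 0" using assms by (cases n) auto
  thus "r div n < m" "r mod n < n" using assms by (auto simp: less_mult_imp_div_less)
qed

lemma kron_carrier [simp]:
  "A \<in> carrier_mat m m' \<Longrightarrow> B \<in> carrier_mat n n' \<Longrightarrow> kron A B \<in> carrier_mat (m * n) (m' * n')"
  by (auto simp: kron_def)

lemma kron_index:
  assumes "A \<in> carrier_mat m m'" "B \<in> carrier_mat n n'" "r < m * n" "c < m' * n'"
  shows "kron A B $$ (r, c) = A $$ (r div n, c div n') * B $$ (r mod n, c mod n')"
  using assms by (auto simp: kron_def)

lemma kron_vec_carrier [simp]: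
  "a \<in> carrier_vec m \<Longrightarrow> b \<in> carrier_vec n \<Longrightarrow> kron_vec a b \<in> carrier_vec (m * n)"
  by (auto simp: kron_vec_def)

lemma kron_vec_index:
  assumes "b \<in> carrier_vec n" "a \<in> carrier_vec m" "r < m * n"
  shows "kron_vec a b $ r = a $ (r div n) * b $ (r mod n)"
  using assms by (auto simp: kron_vec_def)

lemma kron_mult:
  assumes A: "A \<in> carrier_mat m m" and B: "B \<in> carrier_mat n n" and C: "C \<in> carrier_mat m m" and D: "D \<in> carrier_mat n n"
  shows "kron A B * kron C D = kron (A * C) (B * D)"
proof (rule eq_matI)
  fix r c assume "r < dim_row (kron (A * C) (B * D))" "c < dim_col (kron (A * C) (B * D))"
  hence rc: "r < m * n" "c < m * n" using assms by (auto simp: kron_def)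
  note dm = div_mod_less[OF rc(1)] div_mod_less[OF rc(2)]
  have "(kron A B * kron C D) $$ (r, c) = (\<Sum>k<m * n. (A $$ (r div n, k div n) * C $$ (k div n, c div n)) *
      (B $$ (r mod n, k mod n) * D $$ (k mod n, c mod n)))"
    unfolding mult_mat_index_sum[OF kron_carrier[OF A B] kron_carrier[OF C D] rc]
    by (rule sum.cong) (use rc in \<open>auto simp: kron_index[OF A B] kron_index[OF C D]\<close>)
  also have "\<dots> = (\<Sum>i<m. \<Sum>j<n. (A $$ (r div n, i) * C $$ (i, c div n)) * (B $$ (r mod n, j) * D $$ (j, c mod n)))"
    by (rule sum_div_mod)
  also have "\<dots> = (A * C) $$ (r div n, c div n) * (B * D) $$ (r mod n, c mod n)"
    unfolding mult_mat_index_sum[OF A C dm(1,3)] mult_mat_index_sum[OF B D dm(2,4)] by (simp add: sum_product)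
  finally show "(kron A B * kron C D) $$ (r, c) = kron (A * C) (B * D) $$ (r, c)"
    using kron_index[of "A * C" m m "B * D" n n r c] A B C D rc by simp
qed (use assms in \<open>auto simp: kron_def\<close>)

lemma kron_mult_vec:
  assumes A: "A \<in> carrier_mat m m" and B: "B \<in> carrier_mat n n" and a: "a \<in> carrier_vec m" and b: "b \<in> carrier_vec n"
  shows "kron A B *\<^sub>v kron_vec a b = kron_vec (A *\<^sub>v a) (B *\<^sub>v b)"
proof (rule eq_vecI)
  fix r assume "r < dim_vec (kron_vec (A *\<^sub>v a) (B *\<^sub>v b))"
  hence r: "r < m * n" using assms by (auto simp: kron_vec_def)
  note dm = div_mod_less[OF r]
  have "(kron A B *\<^sub>v kron_vec a b) $ r = (\<Sum>k<m * n. (A $$ (r div n, k div n) * a $ (k div n)) *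
      (B $$ (r mod n, k mod n) * b $ (k mod n)))"
    unfolding mult_vec_index_sum[OF kron_carrier[OF A B] kron_vec_carrier[OF a b] r]
    by (rule sum.cong) (use r in \<open>auto simp: kron_index[OF A B] kron_vec_index[OF b a]\<close>)
  also have "\<dots> = (\<Sum>i<m. \<Sum>j<n. (A $$ (r div n, i) * a $ i) * (B $$ (r mod n, j) * b $ j))"
    by (rule sum_div_mod)
  also have "\<dots> = (A *\<^sub>v a) $ (r div n) * (B *\<^sub>v b) $ (r mod n)"
    unfolding mult_vec_index_sum[OF A a dm(1)] mult_vec_index_sum[OF B b dm(2)] by (simp add: sum_product)
  finally show "(kron A B *\<^sub>v kron_vec a b) $ r = kron_vec (A *\<^sub>v a) (B *\<^sub>v b) $ r"
    using kron_vec_index[of "B *\<^sub>v b" n "A *\<^sub>v a" m r] A B a b r by simp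
qed (use assms in \<open>auto simp: kron_def kron_vec_def\<close>)

lemma cscalar_prod_kron_vec:
  assumes "a \<in> carrier_vec m" "b \<in> carrier_vec n" "a' \<in> carrier_vec m" "b' \<in> carrier_vec n"
  shows "kron_vec a b \<bullet>c kron_vec a' b' = (a \<bullet>c a') * (b \<bullet>c b')"
proof -
  have "kron_vec a b \<bullet>c kron_vec a' b' =
      (\<Sum>k<m * n. (a $ (k div n) * cnj (a' $ (k div n))) * (b $ (k mod n) * cnj (b' $ (k mod n))))"
    unfolding cscalar_prod_sum
    by (rule sum.cong) (use assms in \<open>auto simp: kron_vec_def\<close>)
  also have "\<dots> = (\<Sum>i<m. \<Sum>j<n. (a $ i * cnj (a' $ i)) * (b $ j * cnj (b' $ j)))"
    by (rule sum_div_mod)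
  finally show ?thesis using assms by (simp add: cscalar_prod_sum sum_product)
qed

lemma kron_rank_one:
  assumes a: "a \<in> carrier_vec m" and b: "b \<in> carrier_vec n"
  shows "kron (rank_one a) (rank_one b) = rank_one (kron_vec a b)"
proof (rule eq_matI)
  fix r c assume "r < dim_row (rank_one (kron_vec a b))" "c < dim_col (rank_one (kron_vec a b))"
  hence rc: "r < m * n" "c < m * n" using assms by (auto simp: rank_one_def kron_vec_def)
  note dm = div_mod_less[OF rc(1)] div_mod_less[OF rc(2)]
  have "kron (rank_one a) (rank_one b) $$ (r, c) =
      kron_vec a b $ r * cnj (kron_vec a b $ c) / ((a \<bullet>c a) * (b \<bullet>c b))"
    unfolding kron_index[OF rank_one_carrier[OF a] rank_one_carrier[OF b] rc]
      kron_vec_index[OF b a rc(1)] kron_vec_index[OF b a rc(2)]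
    using dm a b by (simp add: rank_one_def)
  thus "kron (rank_one a) (rank_one b) $$ (r, c) = rank_one (kron_vec a b) $$ (r, c)"
    unfolding cscalar_prod_kron_vec[OF a b a b, symmetric]
    using rc carrier_vecD[OF kron_vec_carrier[OF a b]] by (simp add: rank_one_def)
qed (use assms in \<open>auto simp: kron_def rank_one_def kron_vec_def\<close>)

lemma projection_kron:
  assumes "projection m P" "projection n Q"
  shows "projection (m * n) (kron P Q)"
proof -
  have P: "P \<in> carrier_mat m m" "mat_adjoint P = P" "P * P = P"
    and Q: "Q \<in> carrier_mat n n" "mat_adjoint Q = Q" "Q * Q = Q"
    using assms by (auto simp: projection_def)
  have "mat_adjoint (kron P Q) = kron (mat_adjoint P) (mat_adjoint Q)"
  proof (rule eq_matI)
    fix r c assume "r < dim_row (kron (mat_adjoint P) (mat_adjoint Q))" "c < dim_col (kron (mat_adjoint P) (mat_adjoint Q))"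
    hence rc: "r < m * n" "c < m * n" using P Q by (auto simp: kron_def)
    show "mat_adjoint (kron P Q) $$ (r, c) = kron (mat_adjoint P) (mat_adjoint Q) $$ (r, c)"
      using rc P(1) Q(1) carrier_matD[OF kron_carrier[OF P(1) Q(1)]] div_mod_less[OF rc(1)] div_mod_less[OF rc(2)]
      by (simp add: kron_index[OF P(1) Q(1)] kron_index[OF adjoint_carrier[OF P(1)] adjoint_carrier[OF Q(1)]])
  qed (use P Q in \<open>auto simp: kron_def\<close>)
  thus ?thesis using P Q by (simp add: projection_def kron_mult)
qed

text \<open>Two different outcome pairs differ on at least one side, and orthogonality on that side
  already makes the product of the tensor projectors zero.\<close>

lemma resolution_kron:
  assumes f: "resolution m f I" and g: "resolution n g J"
  shows "resolution (m * n) (\<lambda>(i, j). kron (f i) (g j)) (I \<times> J)"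
proof -
  have fc: "f i \<in> carrier_mat m m" if "i \<in> I" for i using f that by (auto simp: resolution_def projection_def)
  have gc: "g j \<in> carrier_mat n n" if "j \<in> J" for j using g that by (auto simp: resolution_def projection_def)
  have "kron (f i) (g j) * kron (f i') (g j') = 0\<^sub>m (m * n) (m * n)"
    if "i \<in> I" "j \<in> J" "i' \<in> I" "j' \<in> J" "(i, j) \<noteq> (i', j')" for i j i' j'
  proof -
    have "f i * f i' = 0\<^sub>m m m \<or> g j * g j' = 0\<^sub>m n n" using that f g by (auto simp: resolution_def)
    moreover have "kron A B = 0\<^sub>m (m * n) (m * n)"
      if "A \<in> carrier_mat m m" "B \<in> carrier_mat n n" "A = 0\<^sub>m m m \<or> B = 0\<^sub>m n n" for A B
      by (rule eq_matI) (use that in \<open>auto simp: kron_index div_mod_less kron_def\<close>)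
    moreover have "f i * f i' \<in> carrier_mat m m" "g j * g j' \<in> carrier_mat n n"
      using that fc gc by (auto intro!: mult_carrier_mat)
    ultimately show ?thesis using that fc gc kron_mult[of "f i" m "g j" n "f i'" "g j'"] by metis
  qed
  moreover have "op_sum (m * n) (\<lambda>(i, j). kron (f i) (g j)) (I \<times> J) = 1\<^sub>m (m * n)"
  proof (rule eq_matI)
    fix r c assume "r < dim_row (1\<^sub>m (m * n) :: complex mat)" "c < dim_col (1\<^sub>m (m * n) :: complex mat)"
    hence rc: "r < m * n" "c < m * n" by auto
    note dm = div_mod_less[OF rc(1)] div_mod_less[OF rc(2)]
    have "op_sum (m * n) (\<lambda>(i, j). kron (f i) (g j)) (I \<times> J) $$ (r, c) =
        (\<Sum>i\<in>I. \<Sum>j\<in>J. f i $$ (r div n, c div n) * g j $$ (r mod n, c mod n))"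
    proof -
      have "kron (f i) (g j) $$ (r, c) = f i $$ (r div n, c div n) * g j $$ (r mod n, c mod n)"
        if "i \<in> I" "j \<in> J" for i j
        using kron_index[OF fc[OF that(1)] gc[OF that(2)] rc] .
      thus ?thesis using rc unfolding sum.cartesian_product
        by (auto simp: op_sum_def case_prod_unfold intro!: sum.cong)
    qed
    also have "\<dots> = op_sum m f I $$ (r div n, c div n) * op_sum n g J $$ (r mod n, c mod n)"
      using dm by (simp add: op_sum_def sum_product)
    also have "\<dots> = 1\<^sub>m (m * n) $$ (r, c)"
    proof -
      have "r = c \<longleftrightarrow> r div n = c div n \<and> r mod n = c mod n" by (metis div_mult_mod_eq)
      thus ?thesis using f g dm rc by (auto simp: resolution_def)
    qed
    finally show "op_sum (m * n) (\<lambda>(i, j). kron (f i) (g j)) (I \<times> J) $$ (r, c) = 1\<^sub>m (m * n) $$ (r, c)" .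
  qed auto
  ultimately show ?thesis using f g by (auto simp: resolution_def intro!: projection_kron)
qed

subsection \<open>The Schmidt decomposition\<close>

text \<open>Diagonalizing the reduced density matrix \<^term>\<open>M * mat_adjoint M\<close> of the coefficient matrix
  \<^term>\<open>M\<close> makes the rows of \<^term>\<open>mat_adjoint U * M\<close> pairwise orthogonal; some of them may vanish.\<close>

lemma schmidt_decomposition:
  assumes \<Psi>: "\<Psi> \<in> carrier_vec (m * n)"
  shows "\<exists>u v. (\<forall>i<m. u i \<in> carrier_vec m) \<and> (\<forall>i<m. v i \<in> carrier_vec n) \<and>
    (\<forall>i<m. \<forall>j<m. u i \<bullet>c u j = (if i = j then 1 else 0)) \<and>
    (\<forall>i<m. \<forall>j<m. i \<noteq> j \<longrightarrow> v i \<bullet>c v j = 0) \<and>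
    \<Psi> = vec_sum (m * n) (\<lambda>i. kron_vec (u i) (v i)) {..<m}"
proof -
  \<comment> \<open>The reshaping inverts the index convention of \<open>kron_vec\<close>, so tensor
    factors become row and column indices.\<close>
  define M where "M = mat m n (\<lambda>(i, j). \<Psi> $ (i * n + j))"
  have M: "M \<in> carrier_mat m n" by (simp add: M_def)
  hence Ma: "mat_adjoint M \<in> carrier_mat n m" by simp
  have H: "M * mat_adjoint M \<in> carrier_mat m m" using M by simp
  have "mat_adjoint (M * mat_adjoint M) = M * mat_adjoint M"
    by (subst adjoint_mult[OF M Ma]) simp
  then obtain U d where U: "U \<in> carrier_mat m m" "mat_adjoint U * U = 1\<^sub>m m"
    "mat_adjoint U * (M * mat_adjoint M) * U = mat_diag m d"
    using hermitian_spectral[OF H] by blast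
  have Ua: "mat_adjoint U \<in> carrier_mat m m" using U by simp
  define N where "N = mat_adjoint U * M"
  have N: "N \<in> carrier_mat m n" unfolding N_def using Ua M by (rule mult_carrier_mat)
  show ?thesis
  proof (rule exI[of _ "col U"], rule exI[of _ "row N"], intro conjI allI impI)
    show "col U i \<in> carrier_vec m" if "i < m" for i using U that by simp
    show "row N i \<in> carrier_vec n" if "i < m" for i using N that by simp
    show "col U i \<bullet>c col U j = (if i = j then 1 else 0)" if "i < m" "j < m" for i j
    proof -
      have "col U i \<bullet>c col U j = (mat_adjoint U * U) $$ (j, i)"
        using U(1) that by (subst mult_mat_index_sum[of _ m m _ m]) (auto simp: cscalar_prod_sum mult.commute)
      thus ?thesis using U(2) that by simp
    qed
    show "row N i \<bullet>c row N j = 0" if "i < m" "j < m" "i \<noteq> j" for i j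
    proof -
      have "mat_adjoint N = mat_adjoint M * U" unfolding N_def using adjoint_mult[OF Ua M] by simp
      hence "N * mat_adjoint N = mat_adjoint U * (M * mat_adjoint M) * U"
        unfolding N_def using Ua U(1) M Ma H
        by (simp add: assoc_mult_mat[OF Ua M mult_carrier_mat[OF Ma U(1)]]
            assoc_mult_mat[OF Ua H U(1)] assoc_mult_mat[OF M Ma U(1)])
      hence "(N * mat_adjoint N) $$ (i, j) = 0" using U(3) that by (simp add: mat_diag_def)
      thus ?thesis using N that
        by (subst (asm) mult_mat_index_sum[of _ m n _ m]) (auto simp: cscalar_prod_sum)
    qed
    \<comment> \<open>This is the matrix identity \<open>U * N = M\<close> read entrywise. The rows
      of \<open>N\<close> stay unnormalized and carry the Schmidt coefficients.\<close>
    show "\<Psi> = vec_sum (m * n) (\<lambda>i. kron_vec (col U i) (row N i)) {..<m}"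
    proof (rule eq_vecI)
      fix r assume "r < dim_vec (vec_sum (m * n) (\<lambda>i. kron_vec (col U i) (row N i)) {..<m})"
      hence r: "r < m * n" by simp
      note dm = div_mod_less[OF r]
      have "U * N = (U * mat_adjoint U) * M" unfolding N_def using assoc_mult_mat[OF U(1) Ua M] by simp
      hence UN: "U * N = M" using unitary_inverse[OF U(1,2)] M by simp
      have "vec_sum (m * n) (\<lambda>i. kron_vec (col U i) (row N i)) {..<m} $ r =
          (\<Sum>i<m. U $$ (r div n, i) * N $$ (i, r mod n))"
        using r U(1) N dm by (auto simp: vec_sum_def kron_vec_def intro!: sum.cong)
      also have "\<dots> = (U * N) $$ (r div n, r mod n)" using mult_mat_index_sum[OF U(1) N dm] by simp
      also have "\<dots> = \<Psi> $ r" unfolding UN using dm by (simp add: M_def)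
      finally show "\<Psi> $ r = vec_sum (m * n) (\<lambda>i. kron_vec (col U i) (row N i)) {..<m} $ r" by simp
    qed (use \<Psi> in simp)
  qed
qed

subsection \<open>Verification operators\<close>

lemma ver_op_carrier [simp]: "ver_op n st \<in> carrier_mat n n"
  by (simp add: ver_op_def)

lemma ver_op_dim [simp]: "dim_row (ver_op n st) = n" "dim_col (ver_op n st) = n"
  by (simp_all add: ver_op_def)

lemma ver_op_Cons:
  assumes "E \<in> carrier_mat n n"
  shows "ver_op n ((p, E) # st) = complex_of_real p \<cdot>\<^sub>m E + ver_op n st"
  using assms by (intro eq_matI) (auto simp: ver_op_def)

lemma ver_op_Cons_mult_vec:
  assumes "E \<in> carrier_mat n n" "x \<in> carrier_vec n"
  shows "ver_op n ((p, E) # st) *\<^sub>v x = complex_of_real p \<cdot>\<^sub>v (E *\<^sub>v x) + ver_op n st *\<^sub>v x"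
  unfolding ver_op_Cons[OF assms(1)]
  using assms
  by (subst add_mult_distrib_mat_vec[of _ n n]) (auto simp: scalar_prod_def sum_distrib_left mult_ac intro!: eq_vecI)

text \<open>The factor is kept as the total weight instead of 1, because the tail of a strategy is
  not normalized and the induction passes through tails.\<close>

lemma ver_op_fixed:
  assumes "\<And>p E. (p, E) \<in> set st \<Longrightarrow> E \<in> carrier_mat n n \<and> E *\<^sub>v x = x" "x \<in> carrier_vec n"
  shows "ver_op n st *\<^sub>v x = complex_of_real (\<Sum>(p, E)\<leftarrow>st. p) \<cdot>\<^sub>v x"
  using assms(1)
proof (induction st)
  case Nil
  show ?case by (rule eq_vecI) (use assms(2) in \<open>auto simp: ver_op_def scalar_prod_def\<close>)
next
  case (Cons pE st)
  obtain p E where pE: "pE = (p, E)" by force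
  have E: "E \<in> carrier_mat n n" "E *\<^sub>v x = x" using Cons.prems pE by auto
  have "ver_op n st *\<^sub>v x = complex_of_real (\<Sum>(p, E)\<leftarrow>st. p) \<cdot>\<^sub>v x"
    by (rule Cons.IH) (use Cons.prems in auto)
  thus ?case unfolding pE ver_op_Cons_mult_vec[OF E(1) assms(2)]
    using E assms(2) by (simp add: add_smult_distrib_vec)
qed

lemma ver_op_cscalar_prod:
  assumes "\<And>p E. (p, E) \<in> set st \<Longrightarrow> E \<in> carrier_mat n n" and x: "x \<in> carrier_vec n"
  shows "Re ((ver_op n st *\<^sub>v x) \<bullet>c x) = (\<Sum>(p, E)\<leftarrow>st. p * Re ((E *\<^sub>v x) \<bullet>c x))"
  using assms(1)
proof (induction st)
  case Nil
  show ?case using x by (simp add: ver_op_def cscalar_prod_sum scalar_prod_def)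
next
  case (Cons pE st)
  obtain p E where pE: "pE = (p, E)" by force
  have E: "E \<in> carrier_mat n n" using Cons.prems pE by auto
  have Ex: "E *\<^sub>v x \<in> carrier_vec n" using E x by simp
  have "(ver_op n ((p, E) # st) *\<^sub>v x) \<bullet>c x =
      complex_of_real p * ((E *\<^sub>v x) \<bullet>c x) + (ver_op n st *\<^sub>v x) \<bullet>c x"
    unfolding ver_op_Cons_mult_vec[OF E x]
    using Ex x mult_mat_vec_carrier[OF ver_op_carrier x]
    by (subst add_scalar_prod_distrib[of _ n]) auto
  moreover have "Re ((ver_op n st *\<^sub>v x) \<bullet>c x) = (\<Sum>(p, E)\<leftarrow>st. p * Re ((E *\<^sub>v x) \<bullet>c x))"
    by (rule Cons.IH) (use Cons.prems in auto)
  ultimately show ?case using pE by simp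
qed

lemma cnj_sum_list: "cnj (sum_list xs) = sum_list (map cnj xs)"
  by (induction xs) auto

lemma ver_op_adjoint:
  assumes "\<And>p E. (p, E) \<in> set st \<Longrightarrow> E \<in> carrier_mat n n \<and> mat_adjoint E = E"
  shows "mat_adjoint (ver_op n st) = ver_op n st"
proof (rule eq_matI)
  fix i j assume "i < dim_row (ver_op n st)" "j < dim_col (ver_op n st)"
  hence ij: "i < n" "j < n" by (auto simp: ver_op_def)
  have "cnj (E $$ (j, i)) = E $$ (i, j)" if "(p, E) \<in> set st" for p E
    using assms[OF that] ij by (metis adjoint_index carrier_matD)
  thus "mat_adjoint (ver_op n st) $$ (i, j) = ver_op n st $$ (i, j)"
    using ij by (auto simp: ver_op_def cnj_sum_list intro!: arg_cong[of _ _ sum_list])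
qed (auto simp: ver_op_def)

lemma valid_strategy_test:
  assumes "valid_strategy n \<Psi> st" "(p, E) \<in> set st"
  shows "0 < p" "E \<in> carrier_mat n n" "mat_adjoint E = E" "E *\<^sub>v \<Psi> = \<Psi>"
    "x \<in> carrier_vec n \<Longrightarrow> Re ((E *\<^sub>v x) \<bullet>c x) \<le> Re (x \<bullet>c x)"
proof -
  have t: "is_test n \<Psi> E" and "0 < p" using assms by (auto simp: valid_strategy_def)
  thus "0 < p" "E \<in> carrier_mat n n" "mat_adjoint E = E" "E *\<^sub>v \<Psi> = \<Psi>" by (auto simp: is_test_def psd_def)
  assume x: "x \<in> carrier_vec n"
  have Ex: "E *\<^sub>v x \<in> carrier_vec n" using \<open>E \<in> carrier_mat n n\<close> x by simp
  have "0 \<le> Re (((1\<^sub>m n - E) *\<^sub>v x) \<bullet>c x)" using t x by (auto simp: is_test_def psd_def)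
  also have "(1\<^sub>m n - E) *\<^sub>v x = x - E *\<^sub>v x"
    using \<open>E \<in> carrier_mat n n\<close> x by (subst minus_mult_distrib_mat_vec[of _ n n]) auto
  also have "(x - E *\<^sub>v x) \<bullet>c x = x \<bullet>c x - (E *\<^sub>v x) \<bullet>c x"
    using x Ex by (intro minus_scalar_prod_distrib[of _ n]) auto
  finally show "Re ((E *\<^sub>v x) \<bullet>c x) \<le> Re (x \<bullet>c x)" by simp
qed

text \<open>The equality case of averaging: the weighted deficits \<open>t - g e\<close> are
  nonnegative and sum to zero, so each vanishes, and positive weights can be cancelled.\<close>

lemma sum_list_weighted_eq:
  fixes g :: "'a \<Rightarrow> real"
  assumes "\<And>p e. (p, e) \<in> set xs \<Longrightarrow> 0 < p \<and> g e \<le> t" "(\<Sum>(p, e)\<leftarrow>xs. p * g e) = (\<Sum>(p, e)\<leftarrow>xs. p) * t"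
    "(p, e) \<in> set xs"
  shows "g e = t"
proof -
  have "(\<Sum>(p, e)\<leftarrow>xs. p * (t - g e)) = 0"
  proof -
    have "(\<Sum>(p, e)\<leftarrow>ys. p * (t - g e)) = (\<Sum>(p, e)\<leftarrow>ys. p) * t - (\<Sum>(p, e)\<leftarrow>ys. p * g e)" for ys
      by (induction ys) (auto simp: algebra_simps)
    thus ?thesis using assms(2) by simp
  qed
  moreover have "\<forall>z\<in>set (map (\<lambda>(p, e). p * (t - g e)) xs). 0 \<le> z"
    using assms(1) by (fastforce simp: less_imp_le)
  ultimately have "\<forall>z\<in>set (map (\<lambda>(p, e). p * (t - g e)) xs). z = 0"
    using sum_list_nonneg_eq_0_iff by blast
  hence "p * (t - g e) = 0" using assms(3) by force
  thus ?thesis using assms(1)[OF assms(3)] by simp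
qed

text \<open>The hypothesis says that the component of \<open>x\<close> under the complementary
  projection has norm zero.\<close>

lemma projection_fixed_if_norm:
  assumes E: "projection n E" and x: "x \<in> carrier_vec n" and eq: "Re ((E *\<^sub>v x) \<bullet>c x) = Re (x \<bullet>c x)"
  shows "E *\<^sub>v x = x"
proof -
  have Ec: "E \<in> carrier_mat n n" using E by (simp add: projection_def)
  hence Ex: "E *\<^sub>v x \<in> carrier_vec n" using x by simp
  let ?y = "(1\<^sub>m n - E) *\<^sub>v x"
  have y: "?y = x - E *\<^sub>v x" using Ec x by (subst minus_mult_distrib_mat_vec[of _ n n]) auto
  have "?y \<bullet>c ?y = ?y \<bullet>c x" using projection_cscalar_prod[OF projection_complement[OF E] x] by simp
  also have "\<dots> = x \<bullet>c x - (E *\<^sub>v x) \<bullet>c x"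
    unfolding y using x Ex by (intro minus_scalar_prod_distrib[of _ n]) auto
  finally have "Re (?y \<bullet>c ?y) = 0" using eq by simp
  hence "x - E *\<^sub>v x = 0\<^sub>v n" unfolding y using cscalar_prod_self_eq_0[of "x - E *\<^sub>v x" n] x Ex by simp
  thus ?thesis using x Ex by (auto simp: vec_eq_iff)
qed

text \<open>Reduces a positive gap to the tests themselves: a vector fixed by the average attains
  the bound \<open>Re ((E *\<^sub>v x) \<bullet>c x) \<le> Re (x \<bullet>c x)\<close> on average,
  hence for every test, and projections that attain it fix the vector.\<close>

lemma spectral_gap_ver_op_pos:
  assumes n: "n \<ge> 2" and valid: "valid_strategy n \<Psi> st" and \<Psi>: "\<Psi> \<in> carrier_vec n"
    and proj: "\<And>p E. (p, E) \<in> set st \<Longrightarrow> projection n E"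
    and coll: "\<And>x. x \<in> carrier_vec n \<Longrightarrow> (\<And>p E. (p, E) \<in> set st \<Longrightarrow> E *\<^sub>v x = x) \<Longrightarrow> \<exists>c. x = c \<cdot>\<^sub>v \<Psi>"
  shows "spectral_gap (ver_op n st) > 0"
proof (rule fixed_collinear_imp_spectral_gap_pos[OF ver_op_carrier _ n _ \<Psi>])
  note test = valid_strategy_test[OF valid]
  have sum1: "(\<Sum>(p, E)\<leftarrow>st. p) = 1" using valid by (simp add: valid_strategy_def)
  show "mat_adjoint (ver_op n st) = ver_op n st" using test by (intro ver_op_adjoint) blast
  have expand: "Re ((ver_op n st *\<^sub>v x) \<bullet>c x) = (\<Sum>(p, E)\<leftarrow>st. p * Re ((E *\<^sub>v x) \<bullet>c x))"
    if "x \<in> carrier_vec n" for x using test that by (intro ver_op_cscalar_prod) blast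
  show "Re ((ver_op n st *\<^sub>v x) \<bullet>c x) \<le> Re (x \<bullet>c x)" if x: "x \<in> carrier_vec n" for x
  proof -
    have "(\<Sum>(p, E)\<leftarrow>st. p * Re ((E *\<^sub>v x) \<bullet>c x)) \<le> (\<Sum>(p, E)\<leftarrow>st. p * Re (x \<bullet>c x))"
    proof (rule sum_list_mono)
      fix pE assume pE: "pE \<in> set st"
      obtain p E where [simp]: "pE = (p, E)" by force
      show "(case pE of (p, E) \<Rightarrow> p * Re ((E *\<^sub>v x) \<bullet>c x)) \<le> (case pE of (p, E) \<Rightarrow> p * Re (x \<bullet>c x))"
        using test(1)[of p E] test(5)[of p E x] x pE by (auto intro!: mult_left_mono)
    qed
    also have "\<dots> = (\<Sum>(p, E)\<leftarrow>st. p) * Re (x \<bullet>c x)"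
      by (simp add: sum_list_mult_const case_prod_unfold)
    finally show ?thesis using expand[OF x] sum1 by simp
  qed
  show "\<exists>c. x = c \<cdot>\<^sub>v \<Psi>" if x: "x \<in> carrier_vec n" and fixed: "ver_op n st *\<^sub>v x = x" for x
  proof (rule coll[OF x])
    fix p E assume pE: "(p, E) \<in> set st"
    have "Re ((E *\<^sub>v x) \<bullet>c x) = Re (x \<bullet>c x)"
    proof (rule sum_list_weighted_eq[OF _ _ pE, of "\<lambda>E. Re ((E *\<^sub>v x) \<bullet>c x)"])
      show "(\<Sum>(p, E)\<leftarrow>st. p * Re ((E *\<^sub>v x) \<bullet>c x)) = (\<Sum>(p, E)\<leftarrow>st. p) * Re (x \<bullet>c x)"
        using expand[OF x] fixed sum1 by simp
    qed (use test x in blast)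
    thus "E *\<^sub>v x = x" using projection_fixed_if_norm[OF proj[OF pE] x] by simp
  qed
qed

subsection \<open>Tests realized by a setting\<close>

lemma realized_test_op_sum:
  "realized_test dA dB s S = op_sum (dA * dB) (\<lambda>(i, j). kron (fst s ! i) (snd s ! j)) S"
  by (simp add: realized_test_def op_sum_def case_prod_unfold)

lemma setting_resolution:
  assumes "setting dA dB s"
  shows "resolution (dA * dB) (\<lambda>(i, j). kron (fst s ! i) (snd s ! j))
    ({0..<length (fst s)} \<times> {0..<length (snd s)})"
  using assms unfolding atLeast0LessThan
  by (intro resolution_kron proj_meas_imp_resolution) (auto simp: setting_def)

lemma realized_test_projection:
  assumes "setting dA dB s" "S \<subseteq> {0..<length (fst s)} \<times> {0..<length (snd s)}"
  shows "projection (dA * dB) (realized_test dA dB s S)"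
  unfolding realized_test_op_sum by (rule resolution_op_sum_projection[OF setting_resolution[OF assms(1)] assms(2)])

lemma realized_test_fixed_iff:
  assumes "setting dA dB s" "S \<subseteq> {0..<length (fst s)} \<times> {0..<length (snd s)}" "x \<in> carrier_vec (dA * dB)"
  shows "realized_test dA dB s S *\<^sub>v x = x \<longleftrightarrow>
    (\<forall>i<length (fst s). \<forall>j<length (snd s). (i, j) \<notin> S \<longrightarrow> kron (fst s ! i) (snd s ! j) *\<^sub>v x = 0\<^sub>v (dA * dB))"
  unfolding realized_test_op_sum resolution_fixed_iff[OF setting_resolution[OF assms(1)] assms(2,3)]
  by (auto simp: Ball_def)

section \<open>Strategies for product and arbitrary states, and the limits of one setting\<close>

lemma product_one_setting:
  assumes d: "dA * dB \<ge> 2" and \<Psi>: "pure_state (dA * dB) \<Psi>" and prod: "product_state dA dB \<Psi>"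
  shows "\<exists>st. verifies dA dB \<Psi> st \<and> uses_settings dA dB st 1"
proof -
  obtain a b where a: "a \<in> carrier_vec dA" and b: "b \<in> carrier_vec dB" and ab: "\<Psi> = kron_vec a b"
    using prod by (auto simp: product_state_def)
  have \<Psi>c: "\<Psi> \<in> carrier_vec (dA * dB)" using \<Psi> by (simp add: pure_state_def)
  define s where "s = ([rank_one a, 1\<^sub>m dA - rank_one a], [rank_one b, 1\<^sub>m dB - rank_one b])"
  have s: "setting dA dB s"
    using proj_meas_two[OF rank_one_projection[OF a]] proj_meas_two[OF rank_one_projection[OF b]]
    by (simp add: setting_def s_def)
  define E where "E = realized_test dA dB s {(0, 0)}"
  \<comment> \<open>Accepting only the joint outcome \<open>(0, 0)\<close> yields the projector onto
    \<open>\<Psi>\<close> itself, the best possible test; the factors \<open>a\<close> and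
    \<open>b\<close> need not be unit vectors.\<close>
  have E_eq: "E = rank_one \<Psi>"
    unfolding E_def realized_test_op_sum ab kron_rank_one[OF a b, symmetric] using a b
    by (intro eq_matI) (auto simp: op_sum_def s_def rank_one_def kron_def)
  have E: "projection (dA * dB) E" unfolding E_eq by (rule rank_one_projection[OF \<Psi>c])
  have "is_test (dA * dB) \<Psi> E"
    unfolding is_test_projection_iff[OF E] unfolding E_eq by (rule rank_one_self[OF \<Psi>c])
  hence valid: "valid_strategy (dA * dB) \<Psi> [(1, E)]" by (simp add: valid_strategy_def)
  have "spectral_gap (ver_op (dA * dB) [(1, E)]) > 0"
  proof (rule spectral_gap_ver_op_pos[OF d valid \<Psi>c])
    fix x assume x: "x \<in> carrier_vec (dA * dB)" and "\<And>p F. (p, F) \<in> set [(1, E)] \<Longrightarrow> F *\<^sub>v x = x"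
    hence "rank_one \<Psi> *\<^sub>v x = x" unfolding E_eq by simp
    thus "\<exists>c. x = c \<cdot>\<^sub>v \<Psi>" using rank_one_mult_vec[OF \<Psi>c x] by metis
  qed (use E in simp)
  moreover have "uses_settings dA dB [(1, E)] 1"
    unfolding uses_settings_def realizes_def
    by (rule exI[of _ "[s]"]) (use s E_def in \<open>auto simp: s_def intro!: exI[of _ "{(0, 0)}"]\<close>)
  ultimately show ?thesis using valid by (auto simp: verifies_def)
qed

text \<open>The first test measures both Schmidt bases and accepts equal outcomes, so it passes exactly the
  vectors \<^term>\<open>vec_sum (m * n) (\<lambda>i. c i \<cdot>\<^sub>v kron_vec (u i) (v i)) {..<m}\<close>. When Alice projects
  such a vector onto the sum of her Schmidt vectors, Bob is left with \<^term>\<open>vec_sum n (\<lambda>i. c i \<cdot>\<^sub>v v i) {..<m}\<close>;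
  the second test rejects if this happens and Bob does not find the state that \<open>\<Psi>\<close> would give him,
  which forces all relevant \<open>c i\<close> to coincide.\<close>

lemma two_settings:
  assumes d: "dA * dB \<ge> 2" and \<Psi>: "pure_state (dA * dB) \<Psi>"
  shows "\<exists>st. verifies dA dB \<Psi> st \<and> uses_settings dA dB st 2"
proof -
  let ?D = "dA * dB" and ?I = "{..<dA}"
  have \<Psi>c: "\<Psi> \<in> carrier_vec ?D" using \<Psi> by (simp add: pure_state_def)
  have dA: "dA > 0" using d by (cases dA) auto
  obtain u v where "\<forall>i<dA. u i \<in> carrier_vec dA" "\<forall>i<dA. v i \<in> carrier_vec dB"
    "\<forall>i<dA. \<forall>j<dA. u i \<bullet>c u j = (if i = j then 1 else 0)"
    "\<forall>i<dA. \<forall>j<dA. i \<noteq> j \<longrightarrow> v i \<bullet>c v j = 0"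
    and schmidt: "\<Psi> = vec_sum ?D (\<lambda>i. kron_vec (u i) (v i)) ?I"
    using schmidt_decomposition[OF \<Psi>c] by blast
  hence u: "\<And>i. i < dA \<Longrightarrow> u i \<in> carrier_vec dA" and v: "\<And>i. i < dA \<Longrightarrow> v i \<in> carrier_vec dB"
    and uu: "\<And>i j. i < dA \<Longrightarrow> j < dA \<Longrightarrow> u i \<bullet>c u j = (if i = j then 1 else 0)"
    and vv: "\<And>i j. i < dA \<Longrightarrow> j < dA \<Longrightarrow> i \<noteq> j \<Longrightarrow> v i \<bullet>c v j = 0" by blast+
  define k where "k i = kron_vec (u i) (v i)" for i
  have k: "k i \<in> carrier_vec ?D" if "i < dA" for i using u[OF that] v[OF that] by (simp add: k_def)
  have kk: "k i \<bullet>c k j = 0" if "i < dA" "j < dA" "i \<noteq> j" for i j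
    using that uu by (simp add: k_def cscalar_prod_kron_vec[of _ dA _ dB] u v)

  define f g where "f i = rank_one (u i)" and "g i = rank_one (v i)" for i
  define s1 where "s1 = (map f [0..<dA] @ [1\<^sub>m dA - op_sum dA f ?I], map g [0..<dA] @ [1\<^sub>m dB - op_sum dB g ?I])"
  have s1: "setting dA dB s1" unfolding setting_def s1_def fst_conv snd_conv
    by (intro conjI proj_meas_completion)
      (auto simp: f_def g_def u v uu vv intro!: rank_one_projection rank_one_orthogonal)
  \<comment> \<open>The completing outcomes have index \<open>dA\<close> on both sides and are never
    accepted.\<close>
  define S1 where "S1 = (\<lambda>i. (i, i)) ` ?I"
  have S1: "S1 \<subseteq> {0..<length (fst s1)} \<times> {0..<length (snd s1)}" by (auto simp: S1_def s1_def)
  define E1 where "E1 = realized_test dA dB s1 S1"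
  have E1: "projection ?D E1" unfolding E1_def by (rule realized_test_projection[OF s1 S1])
  have E1_eq: "E1 = op_sum ?D (\<lambda>i. rank_one (k i)) ?I"
  proof -
    have "E1 = op_sum ?D (\<lambda>i. kron (fst s1 ! i) (snd s1 ! i)) ?I"
      unfolding E1_def realized_test_op_sum op_sum_def S1_def
      by (subst sum.reindex) (auto intro: inj_onI)
    also have "\<dots> = op_sum ?D (\<lambda>i. rank_one (k i)) ?I"
      by (rule op_sum_cong)
        (simp add: s1_def nth_append f_def g_def k_def kron_rank_one[OF u v])
    finally show ?thesis .
  qed
  have E1_mult: "E1 *\<^sub>v x = vec_sum ?D (\<lambda>i. ((x \<bullet>c k i) / (k i \<bullet>c k i)) \<cdot>\<^sub>v k i) ?I"
    if x: "x \<in> carrier_vec ?D" for x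
  proof -
    have "E1 *\<^sub>v x = vec_sum ?D (\<lambda>i. rank_one (k i) *\<^sub>v x) ?I"
      unfolding E1_eq by (rule op_sum_mult_vec[OF _ x]) (simp add: k)
    also have "\<dots> = vec_sum ?D (\<lambda>i. ((x \<bullet>c k i) / (k i \<bullet>c k i)) \<cdot>\<^sub>v k i) ?I"
      by (rule vec_sum_cong) (simp add: rank_one_mult_vec[OF k x])
    finally show ?thesis .
  qed
  have E1\<Psi>: "E1 *\<^sub>v \<Psi> = \<Psi>"
  proof -
    have "((\<Psi> \<bullet>c k i) / (k i \<bullet>c k i)) \<cdot>\<^sub>v k i = k i" if i: "i < dA" for i
    proof -
      have "\<Psi> \<bullet>c k i = (\<Sum>j\<in>?I. k j \<bullet>c k i)"
        unfolding schmidt k_def[symmetric] by (rule vec_sum_cscalar_prod[OF k[OF i]])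
      also have "\<dots> = (\<Sum>j\<in>?I. if j = i then k i \<bullet>c k i else 0)"
        by (rule sum.cong) (use kk i in auto)
      also have "\<dots> = k i \<bullet>c k i" using i by simp
      finally show ?thesis using rank_one_self[OF k[OF i]] rank_one_mult_vec[OF k[OF i] k[OF i]] by simp
    qed
    hence "E1 *\<^sub>v \<Psi> = vec_sum ?D k ?I"
      unfolding E1_mult[OF \<Psi>c] by (intro vec_sum_cong) simp
    thus ?thesis using schmidt by (simp add: k_def[abs_def])
  qed

  \<comment> \<open>\<open>a\<close> is the uniform superposition that hides the Schmidt index, and
    \<open>b\<close> is, up to a factor, the state in which \<open>\<Psi>\<close> leaves Bob when
    Alice finds \<open>a\<close>.\<close>
  define a where "a = vec_sum dA u ?I"
  define b where "b = vec_sum dB v ?I"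
  have a: "a \<in> carrier_vec dA" and b: "b \<in> carrier_vec dB" by (simp_all add: a_def b_def)
  have au: "a \<bullet>c u i = 1" if "i < dA" for i
  proof -
    have "a \<bullet>c u i = (\<Sum>j\<in>?I. if j = i then 1 else 0)"
      unfolding a_def vec_sum_cscalar_prod[OF u[OF that]] by (rule sum.cong) (use uu that in auto)
    thus ?thesis using that by simp
  qed
  have ua: "u i \<bullet>c a = 1" if "i < dA" for i
    using cscalar_prod_commute[OF a u[OF that]] au[OF that] by simp
  have aa: "a \<bullet>c a = of_nat dA"
  proof -
    have "a \<bullet>c a = (\<Sum>j\<in>?I. u j \<bullet>c a)" 
      by (subst (1) a_def) (rule vec_sum_cscalar_prod[OF a])
    thus ?thesis using ua by simp
  qed
  let ?Pb = "1\<^sub>m dB - rank_one b"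
  have Pb: "?Pb \<in> carrier_mat dB dB" using b by (intro minus_carrier_mat) simp
  have Pa: "rank_one a \<in> carrier_mat dA dA" using a by simp
  have Pb_mult: "?Pb *\<^sub>v y = y - rank_one b *\<^sub>v y" if "y \<in> carrier_vec dB" for y
    using b that by (subst minus_mult_distrib_mat_vec[of _ dB dB]) auto
  define Q where "Q = kron (rank_one a) ?Pb"
  have Q: "Q \<in> carrier_mat ?D ?D" unfolding Q_def by (rule kron_carrier[OF Pa Pb])
  \<comment> \<open>The coefficients \<open>c\<close> are kept general: constant 1 gives the test on
    \<open>\<Psi>\<close>, and later they are those of an arbitrary vector passing the first test.
    The factor \<open>1 / of_nat dA\<close> comes from the squared norm of \<open>a\<close>.\<close>
  have Q_mult: "Q *\<^sub>v vec_sum ?D (\<lambda>i. c i \<cdot>\<^sub>v k i) ?I =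
      kron_vec ((1 / of_nat dA) \<cdot>\<^sub>v a) (?Pb *\<^sub>v vec_sum dB (\<lambda>i. c i \<cdot>\<^sub>v v i) ?I)" for c
  proof -
    have Qk: "Q *\<^sub>v (c i \<cdot>\<^sub>v k i) = c i \<cdot>\<^sub>v kron_vec ((1 / of_nat dA) \<cdot>\<^sub>v a) (?Pb *\<^sub>v v i)" if i: "i < dA" for i
    proof -
      have "Q *\<^sub>v k i = kron_vec (rank_one a *\<^sub>v u i) (?Pb *\<^sub>v v i)"
        unfolding Q_def k_def by (rule kron_mult_vec[OF Pa Pb u[OF i] v[OF i]])
      also have "rank_one a *\<^sub>v u i = (1 / of_nat dA) \<cdot>\<^sub>v a"
        using rank_one_mult_vec[OF a u[OF i]] ua[OF i] aa by simp
      finally show ?thesis using mult_mat_vec[OF Q k[OF i]] by simp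
    qed
    have "Q *\<^sub>v vec_sum ?D (\<lambda>i. c i \<cdot>\<^sub>v k i) ?I = vec_sum ?D (\<lambda>i. Q *\<^sub>v (c i \<cdot>\<^sub>v k i)) ?I"
      by (rule mult_mat_vec_sum[OF Q]) (simp add: k)
    also have "\<dots> = vec_sum ?D (\<lambda>i. c i \<cdot>\<^sub>v kron_vec ((1 / of_nat dA) \<cdot>\<^sub>v a) (?Pb *\<^sub>v v i)) ?I"
      by (rule vec_sum_cong) (simp add: Qk)
    also have "\<dots> = kron_vec ((1 / of_nat dA) \<cdot>\<^sub>v a) (vec_sum dB (\<lambda>i. c i \<cdot>\<^sub>v (?Pb *\<^sub>v v i)) ?I)"
    proof (rule eq_vecI)
      fix r assume "r < dim_vec (kron_vec ((1 / of_nat dA) \<cdot>\<^sub>v a) (vec_sum dB (\<lambda>i. c i \<cdot>\<^sub>v (?Pb *\<^sub>v v i)) ?I))"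
      hence r: "r < ?D" using a by (simp add: kron_vec_def)
      note dm = div_mod_less[OF r]
      have Pv: "?Pb *\<^sub>v y \<in> carrier_vec dB" if "y \<in> carrier_vec dB" for y using Pb that by (rule mult_mat_vec_carrier)
      have "(c i \<cdot>\<^sub>v kron_vec ((1 / of_nat dA) \<cdot>\<^sub>v a) (?Pb *\<^sub>v v i)) $ r =
          ((1 / of_nat dA) \<cdot>\<^sub>v a) $ (r div dB) * (c i \<cdot>\<^sub>v (?Pb *\<^sub>v v i)) $ (r mod dB)" if i: "i < dA" for i
      proof -
        have ac: "(1 / of_nat dA) \<cdot>\<^sub>v a \<in> carrier_vec dA" using a by simp
        have "(c i \<cdot>\<^sub>v kron_vec ((1 / of_nat dA) \<cdot>\<^sub>v a) (?Pb *\<^sub>v v i)) $ r =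
            c i * kron_vec ((1 / of_nat dA) \<cdot>\<^sub>v a) (?Pb *\<^sub>v v i) $ r"
          by (rule index_smult_vec) (use r carrier_vecD[OF kron_vec_carrier[OF ac Pv[OF v[OF i]]]] in simp)
        moreover have "(c i \<cdot>\<^sub>v (?Pb *\<^sub>v v i)) $ (r mod dB) = c i * (?Pb *\<^sub>v v i) $ (r mod dB)"
          by (rule index_smult_vec) (use dm carrier_vecD[OF Pv[OF v[OF i]]] in simp)
        ultimately show ?thesis using kron_vec_index[OF Pv[OF v[OF i]] ac r] by simp
      qed
      hence "vec_sum ?D (\<lambda>i. c i \<cdot>\<^sub>v kron_vec ((1 / of_nat dA) \<cdot>\<^sub>v a) (?Pb *\<^sub>v v i)) ?I $ r =
          ((1 / of_nat dA) \<cdot>\<^sub>v a) $ (r div dB) * (\<Sum>i\<in>?I. (c i \<cdot>\<^sub>v (?Pb *\<^sub>v v i)) $ (r mod dB))"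
        using r by (simp add: vec_sum_def sum_distrib_left)
      also have "\<dots> = kron_vec ((1 / of_nat dA) \<cdot>\<^sub>v a) (vec_sum dB (\<lambda>i. c i \<cdot>\<^sub>v (?Pb *\<^sub>v v i)) ?I) $ r"
        using kron_vec_index[of "vec_sum dB (\<lambda>i. c i \<cdot>\<^sub>v (?Pb *\<^sub>v v i)) ?I" dB "(1 / of_nat dA) \<cdot>\<^sub>v a" dA r] r a dm
        by (simp add: vec_sum_def)
      finally show "vec_sum ?D (\<lambda>i. c i \<cdot>\<^sub>v kron_vec ((1 / of_nat dA) \<cdot>\<^sub>v a) (?Pb *\<^sub>v v i)) ?I $ r =
        kron_vec ((1 / of_nat dA) \<cdot>\<^sub>v a) (vec_sum dB (\<lambda>i. c i \<cdot>\<^sub>v (?Pb *\<^sub>v v i)) ?I) $ r" .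
    qed (use a in \<open>simp add: kron_vec_def\<close>)
    also have "vec_sum dB (\<lambda>i. c i \<cdot>\<^sub>v (?Pb *\<^sub>v v i)) ?I = ?Pb *\<^sub>v vec_sum dB (\<lambda>i. c i \<cdot>\<^sub>v v i) ?I"
    proof -
      have "?Pb *\<^sub>v vec_sum dB (\<lambda>i. c i \<cdot>\<^sub>v v i) ?I = vec_sum dB (\<lambda>i. ?Pb *\<^sub>v (c i \<cdot>\<^sub>v v i)) ?I"
        by (rule mult_mat_vec_sum[OF Pb]) (simp add: v)
      also have "\<dots> = vec_sum dB (\<lambda>i. c i \<cdot>\<^sub>v (?Pb *\<^sub>v v i)) ?I"
        by (rule vec_sum_cong) (simp add: mult_mat_vec[OF Pb v])
      finally show ?thesis by simp
    qed
    finally show ?thesis .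
  qed

  define s2 where "s2 = ([rank_one a, 1\<^sub>m dA - rank_one a], [rank_one b, ?Pb])"
  have s2: "setting dA dB s2"
    using proj_meas_two[OF rank_one_projection[OF a]] proj_meas_two[OF rank_one_projection[OF b]]
    by (simp add: setting_def s2_def)
  \<comment> \<open>Only \<open>(0, 1)\<close> is rejected: Alice finds \<open>a\<close> but Bob
    does not find \<open>b\<close>. If Alice misses \<open>a\<close>, the test accepts whatever Bob
    sees, so \<open>Q\<close> is the sole obstruction to passing.\<close>
  define S2 where "S2 = {(0::nat, 0::nat), (1, 0), (1, 1)}"
  have S2: "S2 \<subseteq> {0..<length (fst s2)} \<times> {0..<length (snd s2)}" by (auto simp: S2_def s2_def)
  define E2 where "E2 = realized_test dA dB s2 S2"
  have E2: "projection ?D E2" unfolding E2_def by (rule realized_test_projection[OF s2 S2])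
  have E2_fixed: "E2 *\<^sub>v x = x \<longleftrightarrow> Q *\<^sub>v x = 0\<^sub>v ?D" if "x \<in> carrier_vec ?D" for x
    unfolding E2_def realized_test_fixed_iff[OF s2 S2 that]
    by (auto simp: s2_def S2_def Q_def less_Suc_eq)
  have E2\<Psi>: "E2 *\<^sub>v \<Psi> = \<Psi>"
  proof -
    have "\<Psi> = vec_sum ?D (\<lambda>i. 1 \<cdot>\<^sub>v k i) ?I" using schmidt by (simp add: k_def)
    hence "Q *\<^sub>v \<Psi> = kron_vec ((1 / of_nat dA) \<cdot>\<^sub>v a) (?Pb *\<^sub>v b)"
      using Q_mult[of "\<lambda>_. 1"] by (simp add: b_def)
    also have "?Pb *\<^sub>v b = 0\<^sub>v dB" using Pb_mult[OF b] rank_one_self[OF b] b by simp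
    also have "kron_vec ((1 / of_nat dA) \<cdot>\<^sub>v a) (0\<^sub>v dB) = 0\<^sub>v ?D"
      using a by (intro eq_vecI) (auto simp: kron_vec_def div_mod_less)
    finally show ?thesis using E2_fixed[OF \<Psi>c] by simp
  qed

  \<comment> \<open>The equal weights are a convenience; the argument depends only on the vectors
    fixed by both tests, so any positive weights summing to 1 would do.\<close>
  let ?st = "[(1 / 2 :: real, E1), (1 / 2, E2)]"
  have valid: "valid_strategy ?D \<Psi> ?st"
    using is_test_projection_iff[OF E1] is_test_projection_iff[OF E2] E1\<Psi> E2\<Psi>
    by (simp add: valid_strategy_def)
  have "spectral_gap (ver_op ?D ?st) > 0"
  proof (rule spectral_gap_ver_op_pos[OF d valid \<Psi>c])
    fix x assume x: "x \<in> carrier_vec ?D" and fixed: "\<And>p F. (p, F) \<in> set ?st \<Longrightarrow> F *\<^sub>v x = x"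
    have fix1: "E1 *\<^sub>v x = x" and fix2: "E2 *\<^sub>v x = x"
      using fixed[of "1 / 2" E1] fixed[of "1 / 2" E2] by auto
    define c where "c i = (x \<bullet>c k i) / (k i \<bullet>c k i)" for i
    have xc: "x = vec_sum ?D (\<lambda>i. c i \<cdot>\<^sub>v k i) ?I"
      using fix1 E1_mult[OF x] by (simp add: c_def)
    define w where "w = vec_sum dB (\<lambda>i. c i \<cdot>\<^sub>v v i) ?I"
    have w: "w \<in> carrier_vec dB" by (simp add: w_def)
    define t where "t = (w \<bullet>c b) / (b \<bullet>c b)"
    let ?y = "?Pb *\<^sub>v w" and ?a = "(1 / of_nat dA) \<cdot>\<^sub>v a"
    have y: "?y \<in> carrier_vec dB" using Pb w by (rule mult_mat_vec_carrier)
    have ac: "?a \<in> carrier_vec dA" using a by simp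
    have "kron_vec ?a ?y = 0\<^sub>v ?D"
      using E2_fixed[OF x] fix2 Q_mult[of c] unfolding xc[symmetric] w_def[symmetric] by simp
    \<comment> \<open>The norm of a product vector factorizes, so a vanishing product with
      \<open>?a\<close> nonzero forces Bob's component off \<open>b\<close> to vanish.\<close>
    hence "kron_vec ?a ?y \<bullet>c kron_vec ?a ?y = 0" using kron_vec_carrier[OF ac y] by simp
    hence "(?a \<bullet>c ?a) * (?y \<bullet>c ?y) = 0" unfolding cscalar_prod_kron_vec[OF ac y ac y] .
    moreover have "?a \<bullet>c ?a \<noteq> 0" using a aa dA by (simp add: conjugate_smult_vec)
    ultimately have "?y \<bullet>c ?y = 0" by simp
    hence "?y = 0\<^sub>v dB" using conjugate_square_eq_0_vec[OF y] by blast
    hence "w - t \<cdot>\<^sub>v b = 0\<^sub>v dB" unfolding Pb_mult[OF w] rank_one_mult_vec[OF b w] t_def .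
    hence wt: "w = t \<cdot>\<^sub>v b" using w b by (auto simp: vec_eq_iff)
    \<comment> \<open>The equation is between vectors, not scalars: if \<open>v i\<close> is zero,
      \<open>c i\<close> is a quotient by zero and need not equal \<open>t\<close>, but then
      \<open>k i\<close> is zero as well.\<close>
    have "c i \<cdot>\<^sub>v k i = t \<cdot>\<^sub>v k i" if i: "i < dA" for i
    proof -
      have pick: "vec_sum dB (\<lambda>j. e j \<cdot>\<^sub>v v j) ?I \<bullet>c v i = e i * (v i \<bullet>c v i)" for e
      proof -
        have "vec_sum dB (\<lambda>j. e j \<cdot>\<^sub>v v j) ?I \<bullet>c v i = (\<Sum>j\<in>?I. if j = i then e i * (v i \<bullet>c v i) else 0)"
          unfolding vec_sum_cscalar_prod[OF v[OF i]]
        proof (rule sum.cong[OF refl])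
          fix j assume "j \<in> ?I"
          hence j: "j < dA" by simp
          have "(e j \<cdot>\<^sub>v v j) \<bullet>c v i = e j * (v j \<bullet>c v i)"
            using v[OF j] v[OF i] by (intro smult_scalar_prod_distrib[of _ dB]) auto
          thus "(e j \<cdot>\<^sub>v v j) \<bullet>c v i = (if j = i then e i * (v i \<bullet>c v i) else 0)"
            using vv[OF j i] by simp
        qed
        thus ?thesis using i by simp
      qed
      have "b \<bullet>c v i = v i \<bullet>c v i" using pick[of "\<lambda>_. 1"] by (simp add: b_def)
      moreover have "w \<bullet>c v i = t * (b \<bullet>c v i)"
        unfolding wt by (rule smult_scalar_prod_distrib[of _ dB]) (use b v[OF i] in auto)
      moreover have "w \<bullet>c v i = c i * (v i \<bullet>c v i)" unfolding w_def by (rule pick)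
      ultimately have "c i * (v i \<bullet>c v i) = t * (v i \<bullet>c v i)" by metis
      hence "v i \<bullet>c v i = 0 \<or> c i = t" by (simp only: mult_cancel_right)
      hence "c i = t \<or> v i = 0\<^sub>v dB" using conjugate_square_eq_0_vec[OF v[OF i]] by blast
      thus ?thesis
      proof
        assume "v i = 0\<^sub>v dB"
        hence "k i = 0\<^sub>v ?D" using u[OF i] by (intro eq_vecI) (auto simp: k_def kron_vec_def div_mod_less)
        thus ?thesis by (auto intro!: eq_vecI)
      qed simp
    qed
    hence "x = vec_sum ?D (\<lambda>i. t \<cdot>\<^sub>v k i) ?I" unfolding xc[symmetric] by (subst xc) (auto intro!: vec_sum_cong)
    also have "\<dots> = t \<cdot>\<^sub>v \<Psi>"
      by (subst schmidt, rule eq_vecI) (use carrier_vecD[OF k] in \<open>auto simp: vec_sum_def sum_distrib_left k_def\<close>)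
    finally show "\<exists>c. x = c \<cdot>\<^sub>v \<Psi>" ..
  qed (use E1 E2 in auto)
  moreover have "uses_settings dA dB ?st 2"
    unfolding uses_settings_def realizes_def
    by (rule exI[of _ "[s1, s2]"]) (use s1 s2 S1 S2 E1_def E2_def in auto)
  ultimately show ?thesis using valid by (auto simp: verifies_def)
qed

text \<open>Every accepted set must contain an outcome pair on which \<open>\<Psi>\<close> has a nonzero component. Hence
  every test passes each product vector in the range of the corresponding product projector.\<close>

lemma one_setting_imp_product:
  assumes d: "dA * dB \<ge> 2" and \<Psi>: "pure_state (dA * dB) \<Psi>"
    and ver: "verifies dA dB \<Psi> st" and one: "uses_settings dA dB st 1"
  shows "product_state dA dB \<Psi>"
proof -
  let ?D = "dA * dB"
  have \<Psi>c: "\<Psi> \<in> carrier_vec ?D" and \<Psi>1: "\<Psi> \<bullet>c \<Psi> = 1" using \<Psi> by (auto simp: pure_state_def)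
  have \<Psi>0: "\<Psi> \<noteq> 0\<^sub>v ?D" using \<Psi>1 \<Psi>c by auto
  have valid: "valid_strategy ?D \<Psi> st" and gap: "spectral_gap (ver_op ?D st) > 0"
    using ver by (auto simp: verifies_def)
  note test = valid_strategy_test[OF valid]
  have sum1: "(\<Sum>(p, E)\<leftarrow>st. p) = 1" using valid by (simp add: valid_strategy_def)
  have herm: "mat_adjoint (ver_op ?D st) = ver_op ?D st" using test by (intro ver_op_adjoint) blast
  obtain ss where ss: "length ss \<le> 1" "\<forall>s\<in>set ss. setting dA dB s"
    "\<forall>(p, E)\<in>set st. \<exists>s\<in>set ss. realizes dA dB s E"
    using one by (auto simp: uses_settings_def)
  have "st \<noteq> []" using valid by (simp add: valid_strategy_def)
  then obtain p0 E0 where "(p0, E0) \<in> set st" by (cases st) auto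
  then obtain s where "s \<in> set ss" using ss(3) by blast
  hence "ss = [s]" using ss(1) by (cases ss) auto
  hence s: "setting dA dB s" and real: "\<And>p E. (p, E) \<in> set st \<Longrightarrow> realizes dA dB s E" using ss by auto
  let ?A = "fst s" and ?B = "snd s"
  let ?K = "\<lambda>i j. kron (?A ! i) (?B ! j)"
  have A: "projection dA (?A ! i)" if "i < length ?A" for i
    using s that by (auto simp: setting_def proj_meas_def projection_def)
  have B: "projection dB (?B ! j)" if "j < length ?B" for j
    using s that by (auto simp: setting_def proj_meas_def projection_def)
  have Ac: "?A ! i \<in> carrier_mat dA dA" if "i < length ?A" for i using A[OF that] by (simp add: projection_def)
  have Bc: "?B ! j \<in> carrier_mat dB dB" if "j < length ?B" for j using B[OF that] by (simp add: projection_def)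
  \<comment> \<open>Otherwise all outcomes could be rejected and \<open>\<Psi>\<close> would still
    pass, although the test with empty accepted set is the zero operator.\<close>
  have "\<exists>i j. i < length ?A \<and> j < length ?B \<and> ?K i j *\<^sub>v \<Psi> \<noteq> 0\<^sub>v ?D"
  proof (rule ccontr)
    assume "\<not> ?thesis"
    hence "realized_test dA dB s {} *\<^sub>v \<Psi> = \<Psi>"
      using realized_test_fixed_iff[OF s _ \<Psi>c, of "{}"] by auto
    moreover have "realized_test dA dB s {} *\<^sub>v \<Psi> = 0\<^sub>v ?D"
      using \<Psi>c by (intro eq_vecI) (auto simp: realized_test_def scalar_prod_def)
    ultimately show False using \<Psi>0 by simp
  qed
  then obtain i j where ij: "i < length ?A" "j < length ?B" and nz: "?K i j *\<^sub>v \<Psi> \<noteq> 0\<^sub>v ?D" by blast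
  have fixed: "E *\<^sub>v x = x" if pE: "(p, E) \<in> set st" and x: "x \<in> carrier_vec ?D" "?K i j *\<^sub>v x = x" for p E x
  proof -
    obtain S where S: "S \<subseteq> {0..<length ?A} \<times> {0..<length ?B}" "E = realized_test dA dB s S"
      using real[OF pE] by (auto simp: realizes_def)
    \<comment> \<open>Rejecting an outcome that occurs on \<open>\<Psi>\<close> with nonzero
      amplitude would contradict that every test fixes \<open>\<Psi>\<close>. The same pair
      \<open>(i, j)\<close> therefore serves for all tests.\<close>
    have ijS: "(i, j) \<in> S"
      using test(4)[OF pE] nz ij realized_test_fixed_iff[OF s S(1) \<Psi>c] S(2) by auto
    \<comment> \<open>Seen as a test accepting \<open>(i, j)\<close> alone, the projector shows that
      all other outcomes annihilate \<open>x\<close>; enlarging the accepted set to \<open>S\<close>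
      cannot make \<open>x\<close> fail.\<close>
    have "realized_test dA dB s {(i, j)} *\<^sub>v x = x"
    proof -
      have "realized_test dA dB s {(i, j)} = ?K i j"
        unfolding realized_test_op_sum using kron_carrier[OF Ac[OF ij(1)] Bc[OF ij(2)]]
        by (intro eq_matI) (auto simp: op_sum_def)
      thus ?thesis using x by simp
    qed
    moreover have sub: "{(i, j)} \<subseteq> {0..<length ?A} \<times> {0..<length ?B}" using ij by auto
    ultimately show ?thesis
      using ijS unfolding S(2) realized_test_fixed_iff[OF s S(1) x(1)] realized_test_fixed_iff[OF s sub x(1)]
      by auto
  qed
  \<comment> \<open>Both local projectors are nonzero because their tensor product is; projecting
    suitable \<open>y\<close> and \<open>z\<close> gives a nonzero product vector in the joint
    range.\<close>
  have "\<exists>y\<in>carrier_vec dA. ?A ! i *\<^sub>v y \<noteq> 0\<^sub>v dA"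
  proof (rule ccontr)
    assume "\<not> ?thesis"
    hence "?A ! i = 0\<^sub>m dA dA" using Ac[OF ij(1)] by (intro mat_eq_by_mult_vec[of _ dA dA]) auto
    hence "?K i j = 0\<^sub>m ?D ?D" using Bc[OF ij(2)] by (intro eq_matI) (auto simp: kron_def div_mod_less)
    thus False using nz \<Psi>c by (auto intro!: eq_vecI)
  qed
  then obtain y where y: "y \<in> carrier_vec dA" "?A ! i *\<^sub>v y \<noteq> 0\<^sub>v dA" by blast
  have "\<exists>z\<in>carrier_vec dB. ?B ! j *\<^sub>v z \<noteq> 0\<^sub>v dB"
  proof (rule ccontr)
    assume "\<not> ?thesis"
    hence "?B ! j = 0\<^sub>m dB dB" using Bc[OF ij(2)] by (intro mat_eq_by_mult_vec[of _ dB dB]) auto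
    hence "?K i j = 0\<^sub>m ?D ?D" using Ac[OF ij(1)] by (intro eq_matI) (auto simp: kron_def div_mod_less)
    thus False using nz \<Psi>c by (auto intro!: eq_vecI)
  qed
  then obtain z where z: "z \<in> carrier_vec dB" "?B ! j *\<^sub>v z \<noteq> 0\<^sub>v dB" by blast
  let ?a = "?A ! i *\<^sub>v y" and ?b = "?B ! j *\<^sub>v z"
  have a: "?a \<in> carrier_vec dA" using Ac[OF ij(1)] y(1) by (rule mult_mat_vec_carrier)
  have b: "?b \<in> carrier_vec dB" using Bc[OF ij(2)] z(1) by (rule mult_mat_vec_carrier)
  have xc: "kron_vec ?a ?b \<in> carrier_vec ?D" using a b by (rule kron_vec_carrier)
  have "?K i j *\<^sub>v kron_vec ?a ?b = kron_vec ?a ?b"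
    unfolding kron_mult_vec[OF Ac[OF ij(1)] Bc[OF ij(2)] a b]
    using projection_mult_vec_twice[OF A[OF ij(1)] y(1)] projection_mult_vec_twice[OF B[OF ij(2)] z(1)] by simp
  hence "ver_op ?D st *\<^sub>v kron_vec ?a ?b = complex_of_real (\<Sum>(p, E)\<leftarrow>st. p) \<cdot>\<^sub>v kron_vec ?a ?b"
    using fixed test xc by (intro ver_op_fixed) blast+
  hence xfix: "ver_op ?D st *\<^sub>v kron_vec ?a ?b = kron_vec ?a ?b" using sum1 by simp
  have "ver_op ?D st *\<^sub>v \<Psi> = complex_of_real (\<Sum>(p, E)\<leftarrow>st. p) \<cdot>\<^sub>v \<Psi>"
    using test \<Psi>c by (intro ver_op_fixed) blast+
  hence \<Psi>fix: "ver_op ?D st *\<^sub>v \<Psi> = \<Psi>" using sum1 by simp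
  have "kron_vec ?a ?b \<bullet>c kron_vec ?a ?b \<noteq> 0"
    unfolding cscalar_prod_kron_vec[OF a b a b] using a b y(2) z(2) conjugate_square_eq_0_vec by simp
  hence "kron_vec ?a ?b \<noteq> 0\<^sub>v ?D" using xc by auto
  then obtain c where c: "\<Psi> = c \<cdot>\<^sub>v kron_vec ?a ?b"
    using spectral_gap_pos_imp_fixed_collinear[OF ver_op_carrier herm d gap \<Psi>c \<Psi>fix xc xfix] by blast
  also have "\<dots> = kron_vec (c \<cdot>\<^sub>v ?a) ?b"
    by (rule eq_vecI) (auto simp: kron_vec_def div_mod_less)
  finally show ?thesis using a b unfolding product_state_def by (metis smult_carrier_vec)
qed

text \<open>\<open>uses_settings\<close> bounds the number of settings from above, so for entangled
  states the last two claims together show that two is the minimum. The impossibility is the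
  contrapositive of \<open>one_setting_imp_product\<close>.\<close>

theorem theorem1:
  fixes dA dB :: nat and \<Psi> :: "complex vec"
  assumes "dA * dB \<ge> 2"
    and "pure_state (dA * dB) \<Psi>"
  shows "(product_state dA dB \<Psi> \<longrightarrow> (\<exists>st. verifies dA dB \<Psi> st \<and> uses_settings dA dB st 1))
       \<and> (\<not> product_state dA dB \<Psi> \<longrightarrow>
            (\<exists>st. verifies dA dB \<Psi> st \<and> uses_settings dA dB st 2)
          \<and> \<not> (\<exists>st. verifies dA dB \<Psi> st \<and> uses_settings dA dB st 1))"
  using product_one_setting[OF assms] two_settings[OF assms] one_setting_imp_product[OF assms] by blast

end
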